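(* Let $0<\gamma<1$ and let $F$ be a Banach lattice of $2\pi$-periodic measurable functions on $\mathbb{R}$ such that constants belong to $F$. Then $\mathcal{K}_2$ is bounded as an operator from $L^1(\mathbb{R}_+)\hat\otimes_\pi\Lambda_\gamma^e$ to $F$, and its norm does not exceed $c_\gamma\|1\|_F$, where $$c_\gamma=\gamma^{-1}\pi^{\gamma-1}+\|\mathcal{H}\|_{\Lambda_\gamma\to\Lambda_\gamma}(2\pi)^\gamma .$$
   Context: $\Lambda_\gamma$ is the Hölder space of $2\pi$-periodic functions on $\mathbb{R}$ with exponent $\gamma$, with the semi-norm $\|\phi\|_{\Lambda_\gamma}=\sup_{s\ne t}|\phi(s)-\phi(t)|/|s-t|^\gamma$; $\Lambda_\gamma^e$ is the subspace of even functions in $\Lambda_\gamma$. $X\hat\otimes_\pi Y$ denotes the completion of the algebraic tensor product $X\otimes Y$ in the projective (semi-)norm $\|u\|_\pi=\inf\{\sum_{i=1}^n\|x_i\|\|y_i\| : u=\sum_{i=1}^n x_i\otimes y_i\}$, here formed with the $L^1$ norm and the semi-norm $\|\cdot\|_{\Lambda_\gamma}$. A Banach lattice of measurable functions $F$ is a Banach space of (a.e. classes of) measurable functions such that if $h\in F$, $g$ is measurable and $|g|\le|h|$ a.e., then $g\in F$ and $\|g\|_F\le\|h\|_F$. $\mathcal{H}$ is the periodic Hilbert transform $\mathcal{H}\phi(\alpha)=\frac1{2\pi}\int_{-\pi}^{\pi}\frac{\phi(\alpha-t)}{\tan(t/2)}dt$ (principal value), which by Privalov's theorem is bounded on $\Lambda_\gamma$;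 $\|\mathcal{H}\|_{\Lambda_\gamma\to\Lambda_\gamma}$ is its operator norm with respect to the semi-norm $\|\cdot\|_{\Lambda_\gamma}$. The operator $\mathcal{K}_2$ is formally $$\mathcal{K}_2\varphi(\alpha)=\frac1\pi\int_0^\infty d\rho\int_{-\pi}^{\pi}\frac{\varphi(\rho,\theta)}{\sin(\theta-\alpha)}d\theta .$$ The inner integral is a principal value, i.e. after the substitution $t=\alpha-\theta$ (using $2\pi$-periodicity in $\theta$) it is taken as $\lim_{\varepsilon\to0+}\left(\int_{-\pi+\varepsilon}^{-\varepsilon}+\int_{\varepsilon}^{\pi-\varepsilon}\right)$ in the variable $t$. On elementary tensors $$\mathcal{K}_2(\varphi_1\otimes\varphi_2)(\alpha)=\left(\int_0^\infty\varphi_1(\rho)d\rho\right)\left(\frac1\pi\int_{-\pi}^{\pi}\frac{\varphi_2(\theta)}{\sin(\theta-\alpha)}d\theta\right),$$ extended linearly to the algebraic tensor product, and on the projective tensor product it is understood as the extension by continuity. *)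

theory Defs
  imports "HOL-Analysis.Analysis"
begin

text \<open>
  The scalar field \<open>'k\<close> ranges over \<open>real_normed_field\<close> + \<open>banach\<close>, which covers both the real and
  the complex numbers.  All spaces are given as sets of \<open>'k\<close>-valued functions with pointwise
  operations, together with a semi-norm.  A space of a.e. classes is represented by the set of
  all representatives of its elements.
\<close>

definition function_space :: "('i \<Rightarrow> 'k::field) set \<Rightarrow> bool" where
  "function_space V \<longleftrightarrow>
     (\<lambda>_. 0) \<in> V \<and>
     (\<forall>f\<in>V. \<forall>g\<in>V. (\<lambda>i. f i + g i) \<in> V) \<and>
     (\<forall>c. \<forall>f\<in>V. (\<lambda>i. c * f i) \<in> V)"

definition seminorm_on :: "('i \<Rightarrow> 'k::real_normed_field) set \<Rightarrow> (('i \<Rightarrow> 'k) \<Rightarrow> real) \<Rightarrow> bool" where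
  "seminorm_on V p \<longleftrightarrow>
     (\<forall>f\<in>V. 0 \<le> p f) \<and>
     (\<forall>f\<in>V. \<forall>g\<in>V. p (\<lambda>i. f i + g i) \<le> p f + p g) \<and>
     (\<forall>c. \<forall>f\<in>V. p (\<lambda>i. c * f i) = norm c * p f)"

definition cauchy_seqs ::
    "('i \<Rightarrow> 'k::real_normed_field) set \<Rightarrow> (('i \<Rightarrow> 'k) \<Rightarrow> real) \<Rightarrow> (nat \<Rightarrow> 'i \<Rightarrow> 'k) set" where
  "cauchy_seqs V p =
     {u. (\<forall>n. u n \<in> V) \<and>
         (\<forall>e>0. \<exists>M. \<forall>m\<ge>M. \<forall>n\<ge>M. p (\<lambda>i. u m i - u n i) < e)}"

definition bounded_operator ::
    "'x set \<Rightarrow> ('x \<Rightarrow> real) \<Rightarrow> ('y \<Rightarrow> real) \<Rightarrow> ('x \<Rightarrow> 'y) \<Rightarrow> bool" where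
  "bounded_operator X p q T \<longleftrightarrow> (\<exists>C. \<forall>x\<in>X. q (T x) \<le> C * p x)"

text \<open>The value is meaningful only for operators that satisfy \<^const>\<open>bounded_operator\<close>.\<close>

definition operator_norm ::
    "'x set \<Rightarrow> ('x \<Rightarrow> real) \<Rightarrow> ('y \<Rightarrow> real) \<Rightarrow> ('x \<Rightarrow> 'y) \<Rightarrow> real" where
  "operator_norm X p q T = Inf {C. 0 \<le> C \<and> (\<forall>x\<in>X. q (T x) \<le> C * p x)}"


subsection \<open>Completion of a semi-normed space\<close>

text \<open>Elements are the classes of Cauchy sequences modulo sequences that tend to zero.\<close>

definition seq_class ::
    "('i \<Rightarrow> 'k::real_normed_field) set \<Rightarrow> (('i \<Rightarrow> 'k) \<Rightarrow> real) \<Rightarrow> (nat \<Rightarrow> 'i \<Rightarrow> 'k) \<Rightarrow> (nat \<Rightarrow> 'i \<Rightarrow> 'k) set"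
  where
  "seq_class V p u = {v \<in> cauchy_seqs V p. (\<lambda>n. p (\<lambda>i. u n i - v n i)) \<longlonglongrightarrow> 0}"

definition cauchy_completion ::
    "('i \<Rightarrow> 'k::real_normed_field) set \<Rightarrow> (('i \<Rightarrow> 'k) \<Rightarrow> real) \<Rightarrow> (nat \<Rightarrow> 'i \<Rightarrow> 'k) set set" where
  "cauchy_completion V p = seq_class V p ` cauchy_seqs V p"

definition completion_embed ::
    "('i \<Rightarrow> 'k::real_normed_field) set \<Rightarrow> (('i \<Rightarrow> 'k) \<Rightarrow> real) \<Rightarrow> ('i \<Rightarrow> 'k) \<Rightarrow> (nat \<Rightarrow> 'i \<Rightarrow> 'k) set" where
  "completion_embed V p v = seq_class V p (\<lambda>_. v)"

text \<open>In the next two definitions all members of the union coincide.\<close>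

definition completion_add ::
    "('i \<Rightarrow> 'k::real_normed_field) set \<Rightarrow> (('i \<Rightarrow> 'k) \<Rightarrow> real) \<Rightarrow>
     (nat \<Rightarrow> 'i \<Rightarrow> 'k) set \<Rightarrow> (nat \<Rightarrow> 'i \<Rightarrow> 'k) set \<Rightarrow> (nat \<Rightarrow> 'i \<Rightarrow> 'k) set" where
  "completion_add V p U W = (\<Union>u\<in>U. \<Union>w\<in>W. seq_class V p (\<lambda>n i. u n i + w n i))"

definition completion_scale ::
    "('i \<Rightarrow> 'k::real_normed_field) set \<Rightarrow> (('i \<Rightarrow> 'k) \<Rightarrow> real) \<Rightarrow>
     'k \<Rightarrow> (nat \<Rightarrow> 'i \<Rightarrow> 'k) set \<Rightarrow> (nat \<Rightarrow> 'i \<Rightarrow> 'k) set" where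
  "completion_scale V p c U = (\<Union>u\<in>U. seq_class V p (\<lambda>n i. c * u n i))"

definition completion_norm ::
    "(('i \<Rightarrow> 'k::real_normed_field) \<Rightarrow> real) \<Rightarrow> (nat \<Rightarrow> 'i \<Rightarrow> 'k) set \<Rightarrow> real" where
  "completion_norm p U = (THE l. \<forall>u\<in>U. (\<lambda>n. p (u n)) \<longlonglongrightarrow> l)"


subsection \<open>Projective tensor product\<close>

text \<open>
  The algebraic tensor product of \<open>X\<close> and \<open>Y\<close> is realized as a space of linear functionals on the
  bilinear forms on \<open>X \<times> Y\<close>: the elementary tensor \<open>x \<otimes> y\<close> is evaluation at \<open>(x, y)\<close>, and the tensor
  product consists of the finite sums of elementary tensors.  The relation \<open>E\<close> identifies functions
  that represent the same vector of the first factor (equality almost everywhere below).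
\<close>

definition bilinear_forms ::
    "(('s \<Rightarrow> 'k::field) \<Rightarrow> ('s \<Rightarrow> 'k) \<Rightarrow> bool) \<Rightarrow> ('s \<Rightarrow> 'k) set \<Rightarrow> ('t \<Rightarrow> 'k) set \<Rightarrow>
     (('s \<Rightarrow> 'k) \<Rightarrow> ('t \<Rightarrow> 'k) \<Rightarrow> 'k) set" where
  "bilinear_forms E X Y =
     {B. (\<forall>x\<in>X. \<forall>x'\<in>X. \<forall>y\<in>Y. E x x' \<longrightarrow> B x y = B x' y) \<and>
         (\<forall>x\<in>X. \<forall>x'\<in>X. \<forall>y\<in>Y. B (\<lambda>s. x s + x' s) y = B x y + B x' y) \<and>
         (\<forall>c. \<forall>x\<in>X. \<forall>y\<in>Y. B (\<lambda>s. c * x s) y = c * B x y) \<and>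
         (\<forall>x\<in>X. \<forall>y\<in>Y. \<forall>y'\<in>Y. B x (\<lambda>t. y t + y' t) = B x y + B x y') \<and>
         (\<forall>c. \<forall>x\<in>X. \<forall>y\<in>Y. B x (\<lambda>t. c * y t) = c * B x y)}"

definition elem_tensor ::
    "(('s \<Rightarrow> 'k::field) \<Rightarrow> ('s \<Rightarrow> 'k) \<Rightarrow> bool) \<Rightarrow> ('s \<Rightarrow> 'k) set \<Rightarrow> ('t \<Rightarrow> 'k) set \<Rightarrow>
     ('s \<Rightarrow> 'k) \<Rightarrow> ('t \<Rightarrow> 'k) \<Rightarrow> (('s \<Rightarrow> 'k) \<Rightarrow> ('t \<Rightarrow> 'k) \<Rightarrow> 'k) \<Rightarrow> 'k" where
  "elem_tensor E X Y x y = (\<lambda>B. if B \<in> bilinear_forms E X Y then B x y else 0)"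

definition alg_tensor ::
    "(('s \<Rightarrow> 'k::field) \<Rightarrow> ('s \<Rightarrow> 'k) \<Rightarrow> bool) \<Rightarrow> ('s \<Rightarrow> 'k) set \<Rightarrow> ('t \<Rightarrow> 'k) set \<Rightarrow>
     ((('s \<Rightarrow> 'k) \<Rightarrow> ('t \<Rightarrow> 'k) \<Rightarrow> 'k) \<Rightarrow> 'k) set" where
  "alg_tensor E X Y =
     {(\<lambda>B. \<Sum>i<n. elem_tensor E X Y (x i) (y i) B) | (n::nat) x y. \<forall>i<n. x i \<in> X \<and> y i \<in> Y}"

definition proj_norm ::
    "(('s \<Rightarrow> 'k::field) \<Rightarrow> ('s \<Rightarrow> 'k) \<Rightarrow> bool) \<Rightarrow> ('s \<Rightarrow> 'k) set \<Rightarrow> (('s \<Rightarrow> 'k) \<Rightarrow> real) \<Rightarrow>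
     ('t \<Rightarrow> 'k) set \<Rightarrow> (('t \<Rightarrow> 'k) \<Rightarrow> real) \<Rightarrow> ((('s \<Rightarrow> 'k) \<Rightarrow> ('t \<Rightarrow> 'k) \<Rightarrow> 'k) \<Rightarrow> 'k) \<Rightarrow> real" where
  "proj_norm E X p Y q u =
     Inf {(\<Sum>i<n. p (x i) * q (y i)) | (n::nat) x y.
            (\<forall>i<n. x i \<in> X \<and> y i \<in> Y) \<and> u = (\<lambda>B. \<Sum>i<n. elem_tensor E X Y (x i) (y i) B)}"


subsection \<open>The concrete function spaces\<close>

definition periodic :: "(real \<Rightarrow> 'k) \<Rightarrow> bool" where
  "periodic f \<longleftrightarrow> (\<forall>x. f (x + 2 * pi) = f x)"

definition L1_half :: "(real \<Rightarrow> 'k::{real_normed_field, banach, second_countable_topology}) set" where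
  "L1_half = {f. integrable (lebesgue_on {0..}) f}"

definition L1_half_norm ::
    "(real \<Rightarrow> 'k::{real_normed_field, banach, second_countable_topology}) \<Rightarrow> real" where
  "L1_half_norm f = integral\<^sup>L (lebesgue_on {0..}) (\<lambda>\<rho>. norm (f \<rho>))"

definition ae_eq_half :: "(real \<Rightarrow> 'k) \<Rightarrow> (real \<Rightarrow> 'k) \<Rightarrow> bool" where
  "ae_eq_half f g \<longleftrightarrow> (AE \<rho> in lebesgue_on {0..}. f \<rho> = g \<rho>)"

definition Holder :: "real \<Rightarrow> (real \<Rightarrow> 'k::real_normed_field) set" where
  "Holder \<gamma> = {\<phi>. periodic \<phi> \<and> (\<exists>C. \<forall>s t. norm (\<phi> s - \<phi> t) \<le> C * \<bar>s - t\<bar> powr \<gamma>)}"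

definition Holder_seminorm :: "real \<Rightarrow> (real \<Rightarrow> 'k::real_normed_field) \<Rightarrow> real" where
  "Holder_seminorm \<gamma> \<phi> = Sup {norm (\<phi> s - \<phi> t) / \<bar>s - t\<bar> powr \<gamma> | s t. s \<noteq> t}"

definition Holder_even :: "real \<Rightarrow> (real \<Rightarrow> 'k::real_normed_field) set" where
  "Holder_even \<gamma> = {\<phi> \<in> Holder \<gamma>. \<forall>t. \<phi> (- t) = \<phi> t}"

text \<open>
  Elements of \<open>F\<close> are a.e. classes; by the last clause (with \<open>N\<close> of the zero function equal to \<open>0\<close>)
  the set \<open>F\<close> is saturated under equality almost everywhere among periodic functions, and \<open>N\<close> is
  constant on classes.
\<close>

definition periodic_banach_lattice ::
    "(real \<Rightarrow> 'k::{real_normed_field, banach, second_countable_topology}) set \<Rightarrow>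
     ((real \<Rightarrow> 'k) \<Rightarrow> real) \<Rightarrow> bool" where
  "periodic_banach_lattice F N \<longleftrightarrow>
     F \<subseteq> {f. periodic f \<and> f \<in> borel_measurable lebesgue} \<and>
     function_space F \<and>
     seminorm_on F N \<and>
     (\<forall>f\<in>F. N f = 0 \<longrightarrow> (AE x in lebesgue. f x = 0)) \<and>
     (\<forall>u\<in>cauchy_seqs F N. \<exists>f\<in>F. (\<lambda>n. N (\<lambda>x. u n x - f x)) \<longlonglongrightarrow> 0) \<and>
     (\<forall>h\<in>F. \<forall>g. periodic g \<and> g \<in> borel_measurable lebesgue \<and>
         (AE x in lebesgue. norm (g x) \<le> norm (h x)) \<longrightarrow> g \<in> F \<and> N g \<le> N h)"


subsection \<open>The operators\<close>

text \<open>In the library \<open>tan (pi / 2) = 0\<close> and \<open>x /\<^sub>R 0 = 0\<close>, so the integrand has the right value at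
  \<open>t = \<plusminus>pi\<close>.\<close>

definition hilbert :: "(real \<Rightarrow> 'k::{real_normed_field, banach}) \<Rightarrow> real \<Rightarrow> 'k" where
  "hilbert \<phi> \<alpha> =
     (1 / (2 * pi)) *\<^sub>R
       Lim (at_right 0) (\<lambda>\<epsilon>. integral {-pi..-\<epsilon>} (\<lambda>t. \<phi> (\<alpha> - t) /\<^sub>R tan (t / 2)) +
                             integral {\<epsilon>..pi} (\<lambda>t. \<phi> (\<alpha> - t) /\<^sub>R tan (t / 2)))"

text \<open>
  The angular factor of the operator: \<open>1/\<pi>\<close> times the principal value of the integral of
  \<open>\<phi> \<theta> / sin (\<theta> - \<alpha>)\<close>, written in the variable \<open>t = \<alpha> - \<theta>\<close> and truncated at all three
  singularities \<open>t = 0\<close>, \<open>t = \<plusminus>pi\<close>.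
\<close>

definition K2_angular :: "(real \<Rightarrow> 'k::{real_normed_field, banach}) \<Rightarrow> real \<Rightarrow> 'k" where
  "K2_angular \<phi> \<alpha> =
     (1 / pi) *\<^sub>R
       Lim (at_right 0) (\<lambda>\<epsilon>. integral {-pi + \<epsilon>..-\<epsilon>} (\<lambda>t. \<phi> (\<alpha> - t) /\<^sub>R sin (- t)) +
                             integral {\<epsilon>..pi - \<epsilon>} (\<lambda>t. \<phi> (\<alpha> - t) /\<^sub>R sin (- t)))"

definition K2_elem ::
    "(real \<Rightarrow> 'k::{real_normed_field, banach, second_countable_topology}) \<Rightarrow> (real \<Rightarrow> 'k) \<Rightarrow> real \<Rightarrow> 'k"
  where
  "K2_elem \<phi>1 \<phi>2 \<alpha> = integral\<^sup>L (lebesgue_on {0..}) \<phi>1 * K2_angular \<phi>2 \<alpha>"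

type_synonym 'k tensor = "((real \<Rightarrow> 'k) \<Rightarrow> (real \<Rightarrow> 'k) \<Rightarrow> 'k) \<Rightarrow> 'k"

abbreviation K2_tensor ::
    "real \<Rightarrow> (real \<Rightarrow> 'k::{real_normed_field, banach, second_countable_topology}) \<Rightarrow> (real \<Rightarrow> 'k) \<Rightarrow> 'k tensor"
  where
  "K2_tensor \<gamma> \<phi>1 \<phi>2 \<equiv> elem_tensor ae_eq_half L1_half (Holder_even \<gamma>) \<phi>1 \<phi>2"

abbreviation K2_alg_dom ::
    "real \<Rightarrow> 'k::{real_normed_field, banach, second_countable_topology} tensor set" where
  "K2_alg_dom \<gamma> \<equiv> alg_tensor ae_eq_half L1_half (Holder_even \<gamma>)"

abbreviation K2_alg_norm ::
    "real \<Rightarrow> 'k::{real_normed_field, banach, second_countable_topology} tensor \<Rightarrow> real" where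
  "K2_alg_norm \<gamma> \<equiv>
     proj_norm ae_eq_half L1_half L1_half_norm (Holder_even \<gamma>) (Holder_seminorm \<gamma>)"

abbreviation K2_dom ::
    "real \<Rightarrow> (nat \<Rightarrow> 'k::{real_normed_field, banach, second_countable_topology} tensor) set set" where
  "K2_dom \<gamma> \<equiv> cauchy_completion (K2_alg_dom \<gamma>) (K2_alg_norm \<gamma>)"

abbreviation K2_dom_norm ::
    "real \<Rightarrow> (nat \<Rightarrow> 'k::{real_normed_field, banach, second_countable_topology} tensor) set \<Rightarrow> real" where
  "K2_dom_norm \<gamma> \<equiv> completion_norm (K2_alg_norm \<gamma>)"

abbreviation K2_dom_add where
  "K2_dom_add \<gamma> \<equiv> completion_add (K2_alg_dom \<gamma>) (K2_alg_norm \<gamma>)"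

abbreviation K2_dom_scale where
  "K2_dom_scale \<gamma> \<equiv> completion_scale (K2_alg_dom \<gamma>) (K2_alg_norm \<gamma>)"

text \<open>
  \<open>is_K2 \<gamma> F N K\<close>: the map \<open>K\<close> from the completed tensor product to \<open>F\<close> is linear (as a map into
  a.e. classes), continuous, and given by \<^const>\<open>K2_elem\<close> on elementary tensors, i.e. it is the
  extension by continuity of the linear operator that \<^const>\<open>K2_elem\<close> determines on the algebraic
  tensor product.
\<close>

definition is_K2 ::
    "real \<Rightarrow> (real \<Rightarrow> 'k::{real_normed_field, banach, second_countable_topology}) set \<Rightarrow>
     ((real \<Rightarrow> 'k) \<Rightarrow> real) \<Rightarrow> ((nat \<Rightarrow> 'k tensor) set \<Rightarrow> real \<Rightarrow> 'k) \<Rightarrow> bool" where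
  "is_K2 \<gamma> F N K \<longleftrightarrow>
     (\<forall>U\<in>K2_dom \<gamma>. K U \<in> F) \<and>
     (\<forall>U\<in>K2_dom \<gamma>. \<forall>W\<in>K2_dom \<gamma>.
        AE \<alpha> in lebesgue. K (K2_dom_add \<gamma> U W) \<alpha> = K U \<alpha> + K W \<alpha>) \<and>
     (\<forall>c. \<forall>U\<in>K2_dom \<gamma>. AE \<alpha> in lebesgue. K (K2_dom_scale \<gamma> c U) \<alpha> = c * K U \<alpha>) \<and>
     (\<forall>Us. \<forall>U\<in>K2_dom \<gamma>.
        (\<forall>n. Us n \<in> K2_dom \<gamma>) \<and>
        (\<lambda>n. K2_dom_norm \<gamma> (K2_dom_add \<gamma> (Us n) (K2_dom_scale \<gamma> (- 1) U))) \<longlonglongrightarrow> 0 \<longrightarrow>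
        (\<lambda>n. N (\<lambda>\<alpha>. K (Us n) \<alpha> - K U \<alpha>)) \<longlonglongrightarrow> 0) \<and>
     (\<forall>\<phi>1\<in>L1_half. \<forall>\<phi>2\<in>Holder_even \<gamma>.
        AE \<alpha> in lebesgue.
          K (completion_embed (K2_alg_dom \<gamma>) (K2_alg_norm \<gamma>) (K2_tensor \<gamma> \<phi>1 \<phi>2)) \<alpha> =
          K2_elem \<phi>1 \<phi>2 \<alpha>)"

end

theory Submission
  imports Defs
begin

text \<open>
  The kernel \<open>1 / sin\<close> is half the difference of two Hilbert kernels shifted by \<open>pi\<close>, so the angular
  factor of the operator is \<open>\<phi> \<mapsto> \<H>\<phi>(\<alpha> + pi) - \<H>\<phi>(\<alpha>)\<close>.  Privalov's theorem then bounds it uniformly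
  in \<open>\<alpha>\<close> by \<open>\<parallel>\<H>\<parallel> pi\<^sup>\<gamma> \<parallel>\<phi>\<parallel>\<close>, which is at most \<open>c\<^sub>\<gamma> \<parallel>\<phi>\<parallel>\<close>.  Hence for each fixed \<open>\<alpha>\<close> the operator is a bounded
  bilinear form, that is, evaluation at this form is a functional on the projective tensor product
  with norm at most \<open>c\<^sub>\<gamma>\<close>, which extends to the completion.  A measurable function bounded by a constant
  \<open>r\<close> belongs to \<open>F\<close> with norm at most \<open>r \<parallel>1\<parallel>\<close>.
\<close>

section \<open>Privalov's theorem and the angular operator\<close>

text \<open>\<open>hilbert\<close> and \<open>K2_angular\<close> are defined through
  \<open>Lim\<close>, which is arbitrary where no limit exists, so convergence of the truncated
  integrals has to precede every estimate and even linearity. Privalov's theorem is then proved with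
  an explicit constant whose value never enters the final bound: it makes the set of admissible
  constants in \<open>operator_norm\<close> nonempty, so that its infimum is itself admissible and
  can replace the explicit constant.

  Because the angular estimate is uniform in \<alpha>, the operator on the completion can be built
  point by point, from limits of scalars instead of limits in F. Linearity then holds at every
  \<alpha>, while periodicity and measurability pass to the pointwise limit.

  Uniqueness is a separate argument. Elementary tensors determine a competitor on finite sums up to
  null sets; density and continuity carry the agreement to the completion, where a difference of
  F-norm zero vanishes almost everywhere.\<close>

lemma sin_ge_linear:
  fixes x :: real
  assumes "0 \<le> x" "x \<le> pi / 2"
  shows "2 * x / pi \<le> sin x"
proof -
  \<comment> \<open>Jordan's inequality: the graph of the concave function sin lies above its chord
    from 0 to pi / 2.\<close>
  have "convex_on {0..pi} (\<lambda>x::real. - sin x)"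
    by (rule f''_ge0_imp_convex[where f' = "\<lambda>x. - cos x" and f'' = "\<lambda>x. sin x"])
       (auto intro!: derivative_eq_intros sin_ge_zero)
  then have "- sin ((1 - 2 * x / pi) *\<^sub>R 0 + (2 * x / pi) *\<^sub>R (pi / 2))
      \<le> (1 - 2 * x / pi) * (- sin 0) + (2 * x / pi) * (- sin (pi / 2))"
    using assms by (intro convex_onD) (auto simp: field_simps)
  then show ?thesis by simp
qed

text \<open>Jordan's inequality covers the half near 0; the reflection t -> 2 pi - t moves the half
  near the other zero 2 pi onto it.\<close>

lemma sin_half_ge:
  fixes t :: real
  assumes "0 \<le> t" "t \<le> 2 * pi"
  shows "min t (2 * pi - t) / pi \<le> sin (t / 2)"
proof (cases "t \<le> pi")
  case True
  then show ?thesis using sin_ge_linear[of "t / 2"] assms by simp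
next
  case False
  have "sin (t / 2) = sin ((2 * pi - t) / 2)"
    by (simp add: sin_diff diff_divide_distrib)
  moreover have "2 * ((2 * pi - t) / 2) = 2 * pi - t" by simp
  ultimately show ?thesis using sin_ge_linear[of "(2 * pi - t) / 2"] assms False
    by (simp only: min_def split: if_split) auto
qed

lemma sin_half_pos: "0 < t \<Longrightarrow> t < 2 * pi \<Longrightarrow> 0 < sin (t / 2)" for t :: real
  by (intro sin_gt_zero) auto

text \<open>Size estimate for the Hilbert kernel, in terms of the distance to the nearer
  singularity.\<close>

lemma abs_cot_half_le:
  fixes t :: real
  assumes "0 < t" "t < 2 * pi"
  shows "\<bar>cot (t / 2)\<bar> \<le> pi / min t (2 * pi - t)"
proof -
  define d where "d = min t (2 * pi - t)"
  have d: "0 < d" "d / pi \<le> sin (t / 2)"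
    using assms sin_half_ge[of t] by (simp_all add: d_def)
  have "\<bar>cot (t / 2)\<bar> = \<bar>cos (t / 2)\<bar> / sin (t / 2)"
    using sin_half_pos[OF assms] by (simp add: cot_def)
  also have "\<dots> \<le> 1 / (d / pi)"
    using d by (intro frac_le) simp_all
  finally show ?thesis by (simp add: d_def)
qed

text \<open>Smoothness estimate for the kernel: cot x - cot y = sin (y - x) / (sin x sin y) gains a
  factor |s - t| at the price of a second distance in the denominator.\<close>

lemma abs_cot_half_diff_le:
  fixes s t :: real
  assumes "0 < s" "s < 2 * pi" "0 < t" "t < 2 * pi"
  shows "\<bar>cot (s / 2) - cot (t / 2)\<bar>
    \<le> pi\<^sup>2 * \<bar>s - t\<bar> / (2 * min s (2 * pi - s) * min t (2 * pi - t))"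
proof -
  define d e where "d = min s (2 * pi - s)" and "e = min t (2 * pi - t)"
  have d: "0 < d" "d / pi \<le> sin (s / 2)" and e: "0 < e" "e / pi \<le> sin (t / 2)"
    using assms sin_half_ge[of s] sin_half_ge[of t] by (simp_all add: d_def e_def)
  note pos = sin_half_pos[OF assms(1,2)] sin_half_pos[OF assms(3,4)]
  have "cos x / sin x - cos y / sin y = sin (y - x) / (sin x * sin y)"
    if "sin x \<noteq> 0" "sin y \<noteq> 0" for x y :: real
    using that by (simp add: sin_diff diff_frac_eq)
  from this[of "s / 2" "t / 2"]
  have "\<bar>cot (s / 2) - cot (t / 2)\<bar> = \<bar>sin (t / 2 - s / 2)\<bar> / (sin (s / 2) * sin (t / 2))"
    using pos by (simp add: cot_def)
  also have "\<dots> \<le> (\<bar>s - t\<bar> / 2) / ((d / pi) * (e / pi))"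
  proof (rule frac_le)
    have "\<bar>t / 2 - s / 2\<bar> = \<bar>s - t\<bar> / 2"
      by (simp add: abs_minus_commute flip: diff_divide_distrib)
    then show "\<bar>sin (t / 2 - s / 2)\<bar> \<le> \<bar>s - t\<bar> / 2"
      using abs_sin_x_le_abs_x[of "t / 2 - s / 2"] by linarith
    show "(d / pi) * (e / pi) \<le> sin (s / 2) * sin (t / 2)"
      using d e pos by (intro mult_mono) simp_all
  qed (use d e in simp_all)
  also have "\<dots> = pi\<^sup>2 * \<bar>s - t\<bar> / (2 * d * e)"
    by (simp add: power2_eq_square mult_ac)
  finally show ?thesis by (simp only: d_def e_def)
qed

text \<open>The exponent has the form s - 1 to serve two cases: s = \<gamma> for the integrable
  singularity of the principal value, and the negative s = \<gamma> - 1 for the smoothness part of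
  Privalov's estimate.\<close>

lemma powr_has_integral:
  fixes a b s :: real
  assumes "0 < a" "a \<le> b" "s \<noteq> 0"
  shows "((\<lambda>t. t powr (s - 1)) has_integral ((b powr s - a powr s) / s)) {a..b}"
proof -
  have "((\<lambda>t. t powr (s - 1)) has_integral (b powr s / s - a powr s / s)) {a..b}"
    using assms
    by (intro fundamental_theorem_of_calculus)
       (auto intro!: derivative_eq_intros simp flip: has_real_derivative_iff_has_vector_derivative)
  then show ?thesis by (simp add: diff_divide_distrib)
qed

lemma powr_reflect_has_integral:
  fixes a b c s :: real
  assumes "b < c" "a \<le> b" "s \<noteq> 0"
  shows "((\<lambda>t. (c - t) powr (s - 1)) has_integral (((c - a) powr s - (c - b) powr s) / s)) {a..b}"
proof -
  have "((\<lambda>t. (c - t) powr (s - 1)) has_integral (- ((c - b) powr s / s) - - ((c - a) powr s / s))) {a..b}"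
    using assms
    by (intro fundamental_theorem_of_calculus)
       (auto intro!: derivative_eq_intros simp flip: has_real_derivative_iff_has_vector_derivative)
  then show ?thesis by (simp add: diff_divide_distrib)
qed

text \<open>Stated for a bare bound so that it applies both to the given function and, later, to its
  Hilbert transform.\<close>

lemma continuous_on_Holder_bound:
  fixes f :: "real \<Rightarrow> 'b::real_normed_vector"
  assumes "0 < \<gamma>" "\<And>s t. norm (f s - f t) \<le> C * \<bar>s - t\<bar> powr \<gamma>"
  shows "continuous_on A f"
proof -
  have "isCont f x" for x
  proof -
    have "((\<lambda>t. C * \<bar>t - x\<bar> powr \<gamma>) \<longlongrightarrow> C * 0 powr \<gamma>) (at x)"
      using assms(1) by (intro tendsto_intros tendsto_powr') (auto intro!: tendsto_eq_intros)
    then have "((\<lambda>t. C * \<bar>t - x\<bar> powr \<gamma>) \<longlongrightarrow> 0) (at x)" by simp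
    then have "((\<lambda>t. f t - f x) \<longlongrightarrow> 0) (at x)"
      by (rule Lim_null_comparison[rotated]) (use assms(2) in auto)
    then show ?thesis by (simp add: isCont_def LIM_zero_iff)
  qed
  then show ?thesis by (simp add: continuous_at_imp_continuous_on)
qed

lemma integral_reflect_Icc:
  fixes f :: "real \<Rightarrow> 'b::real_normed_vector"
  shows "integral {a..b} (\<lambda>t. f (c - t)) = integral {c - b..c - a} f"
proof -
  have "integral {a..b} (\<lambda>t. f (c - t)) = integral {-b..-a} (\<lambda>t. f (c + t))"
    using Henstock_Kurzweil_Integration.integral_reflect_real[of "- a" "- b" "\<lambda>t. f (c + t)"] by simp
  also have "\<dots> = integral {c - b..c - a} f"
    using integral_shift_Icc_real[of "-b" "-a" f c] by (simp add: o_def add.commute)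
  finally show ?thesis .
qed

lemma continuous_cot_half [continuous_intros]:
  "A \<subseteq> {0<..<2 * pi} \<Longrightarrow> continuous_on A (\<lambda>t. cot (t / 2) :: real)"
  unfolding cot_def
proof (intro continuous_intros ballI)
  fix t assume "A \<subseteq> {0<..<2 * pi}" "t \<in> A"
  then show "sin (t / 2) \<noteq> 0" using sin_half_pos[of t] by auto
qed auto

section \<open>Truncated Hilbert integrals and existence of the principal value\<close>

locale holder_function =
  fixes \<phi> :: "real \<Rightarrow> 'k::{real_normed_field, banach}" and \<gamma> C :: real
  assumes \<gamma>: "0 < \<gamma>" "\<gamma> < 1"
    and periodic: "\<phi> (x + 2 * pi) = \<phi> x"
    and holder: "norm (\<phi> s - \<phi> t) \<le> C * \<bar>s - t\<bar> powr \<gamma>"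
begin

lemma C_nonneg: "0 \<le> C"
  using order_trans[OF norm_ge_zero holder[of 1 0]] by simp

lemma periodic': "\<phi> (x - 2 * pi) = \<phi> x"
  using periodic[of "x - 2 * pi"] by simp

lemma continuous: "continuous_on A \<phi>"
  using \<gamma>(1) holder by (rule continuous_on_Holder_bound)

lemma continuous_compose [continuous_intros]:
  "continuous_on A g \<Longrightarrow> continuous_on A (\<lambda>t. \<phi> (g t))"
  using continuous_on_compose2[OF continuous[of UNIV], of A g] by auto

text \<open>By periodicity this is the symmetric truncation around 0, moved to the period (0, 2 pi).
  There sin (t / 2) is positive and the domain is a single interval, which makes translations
  easy.\<close>

definition trunc :: "real \<Rightarrow> real \<Rightarrow> 'k" where
  "trunc \<epsilon> \<alpha> = integral {\<epsilon>..2 * pi - \<epsilon>} (\<lambda>t. cot (t / 2) *\<^sub>R \<phi> (\<alpha> - t))"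

text \<open>Folding [pi, 2 pi - \<epsilon>] by t -> 2 pi - t flips the sign of the kernel. The
  difference of \<phi> that appears is of order t^\<gamma> and tames the singularity 1 / t.\<close>

lemma trunc_eq_symmetric:
  assumes "0 < \<epsilon>" "\<epsilon> \<le> pi"
  shows "trunc \<epsilon> \<alpha> = integral {\<epsilon>..pi} (\<lambda>t. cot (t / 2) *\<^sub>R (\<phi> (\<alpha> - t) - \<phi> (\<alpha> + t)))"
proof -
  have i1: "(\<lambda>t. cot (t / 2) *\<^sub>R \<phi> (\<alpha> - t)) integrable_on {\<epsilon>..2 * pi - \<epsilon>}"
    and i2: "(\<lambda>t. cot (t / 2) *\<^sub>R \<phi> (\<alpha> - t)) integrable_on {\<epsilon>..pi}"
    and i3: "(\<lambda>t. cot (t / 2) *\<^sub>R \<phi> (\<alpha> + t)) integrable_on {\<epsilon>..pi}"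
    using assms by (intro integrable_continuous_interval continuous_intros; auto)+
  have "integral {pi..2 * pi - \<epsilon>} (\<lambda>t. cot (t / 2) *\<^sub>R \<phi> (\<alpha> - t))
      = integral {\<epsilon>..pi} (\<lambda>t. cot ((2 * pi - t) / 2) *\<^sub>R \<phi> (\<alpha> - (2 * pi - t)))"
    by (subst integral_reflect_Icc) simp
  also have "\<dots> = integral {\<epsilon>..pi} (\<lambda>t. - (cot (t / 2) *\<^sub>R \<phi> (\<alpha> + t)))"
  proof (rule integral_cong)
    fix t
    have "\<phi> (\<alpha> - (2 * pi - t)) = \<phi> (\<alpha> + t)"
      using periodic'[of "\<alpha> + t"] by (simp add: algebra_simps)
    moreover have "cot ((2 * pi - t) / 2) = - cot (t / 2)"
      by (simp add: cot_def diff_divide_distrib sin_diff cos_diff)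
    ultimately show "cot ((2 * pi - t) / 2) *\<^sub>R \<phi> (\<alpha> - (2 * pi - t)) = - (cot (t / 2) *\<^sub>R \<phi> (\<alpha> + t))"
      by simp
  qed
  also have "\<dots> = - integral {\<epsilon>..pi} (\<lambda>t. cot (t / 2) *\<^sub>R \<phi> (\<alpha> + t))" by simp
  finally show ?thesis
    using Henstock_Kurzweil_Integration.integral_combine[OF _ _ i1, of pi] assms i2 i3
    by (simp add: trunc_def scaleR_diff_right integral_diff algebra_simps)
qed

text \<open>The reflection t -> -t folds the left integral onto the right one.
  \<open>cot_altdef\<close> holds without side conditions, since division by zero gives 0; hence the
  endpoints pi and -pi need no separate treatment.\<close>

lemma hilbert_trunc:
  assumes "0 < \<epsilon>" "\<epsilon> \<le> pi"
  shows "integral {-pi..-\<epsilon>} (\<lambda>t. \<phi> (\<alpha> - t) /\<^sub>R tan (t / 2)) +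
         integral {\<epsilon>..pi} (\<lambda>t. \<phi> (\<alpha> - t) /\<^sub>R tan (t / 2)) = trunc \<epsilon> \<alpha>"
proof -
  have i1: "(\<lambda>t. cot (t / 2) *\<^sub>R \<phi> (\<alpha> - t)) integrable_on {\<epsilon>..pi}"
    and i2: "(\<lambda>t. cot (t / 2) *\<^sub>R \<phi> (\<alpha> + t)) integrable_on {\<epsilon>..pi}"
    using assms by (intro integrable_continuous_interval continuous_intros; auto)+
  have "integral {-pi..-\<epsilon>} (\<lambda>t. cot (t / 2) *\<^sub>R \<phi> (\<alpha> - t))
      = - integral {\<epsilon>..pi} (\<lambda>t. cot (t / 2) *\<^sub>R \<phi> (\<alpha> + t))"
    using integral_reflect_Icc[of \<epsilon> pi "\<lambda>t. cot (t / 2) *\<^sub>R \<phi> (\<alpha> - t)" 0] by simp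
  then show ?thesis
    using i1 i2 assms
    by (simp add: trunc_eq_symmetric scaleR_diff_right integral_diff flip: cot_altdef)
qed

text \<open>On [\<epsilon>, \<delta>] the kernel is at most pi / t and the two arguments of \<phi>
  lie 2 t apart, so the folded integrand is dominated by a multiple of t^(\<gamma> - 1), which is
  integrable at 0.\<close>

lemma norm_trunc_diff_le:
  assumes "0 < \<epsilon>" "\<epsilon> \<le> \<delta>" "\<delta> \<le> pi"
  shows "norm (trunc \<epsilon> \<alpha> - trunc \<delta> \<alpha>) \<le> 2 powr \<gamma> * pi * C * (\<delta> powr \<gamma> - \<epsilon> powr \<gamma>) / \<gamma>"
proof -
  let ?f = "\<lambda>t. cot (t / 2) *\<^sub>R (\<phi> (\<alpha> - t) - \<phi> (\<alpha> + t))"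
  have int: "?f integrable_on {\<epsilon>..pi}" "?f integrable_on {\<epsilon>..\<delta>}"
    using assms by (intro integrable_continuous_interval continuous_intros; auto)+
  have "trunc \<epsilon> \<alpha> - trunc \<delta> \<alpha> = integral {\<epsilon>..\<delta>} ?f"
    using Henstock_Kurzweil_Integration.integral_combine[OF _ _ int(1), of \<delta>] assms
    by (simp add: trunc_eq_symmetric algebra_simps)
  also have "norm \<dots> \<le> integral {\<epsilon>..\<delta>} (\<lambda>t. 2 powr \<gamma> * pi * C * t powr (\<gamma> - 1))"
  proof (rule Henstock_Kurzweil_Integration.integral_norm_bound_integral)
    show "(\<lambda>t. 2 powr \<gamma> * pi * C * t powr (\<gamma> - 1)) integrable_on {\<epsilon>..\<delta>}"
      using assms by (intro integrable_continuous_interval continuous_intros) auto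
    fix t assume t: "t \<in> {\<epsilon>..\<delta>}"
    have "\<bar>cot (t / 2)\<bar> \<le> pi / t"
      using abs_cot_half_le[of t] t assms pi_gt_zero by (simp add: min_def split: if_splits)
    moreover have "norm (\<phi> (\<alpha> - t) - \<phi> (\<alpha> + t)) \<le> C * (2 * t) powr \<gamma>"
      using holder[of "\<alpha> - t" "\<alpha> + t"] t assms by simp
    ultimately have "norm (?f t) \<le> pi / t * (C * (2 * t) powr \<gamma>)"
      unfolding norm_scaleR using t assms by (intro mult_mono) auto
    also have "\<dots> = 2 powr \<gamma> * pi * C * t powr (\<gamma> - 1)"
      using t assms by (simp add: powr_mult powr_diff)
    finally show "norm (?f t) \<le> \<dots>" .
  qed (use int in auto)
  also have "\<dots> = 2 powr \<gamma> * pi * C * ((\<delta> powr \<gamma> - \<epsilon> powr \<gamma>) / \<gamma>)"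
    using has_integral_mult_right[OF powr_has_integral[of \<epsilon> \<delta> \<gamma>], of "2 powr \<gamma> * pi * C"] assms \<gamma>
    by (intro integral_unique) auto
  finally show ?thesis by simp
qed

text \<open>Independence of the smaller cutoff is the point: it gives the Cauchy property and
  survives \<epsilon> -> 0.\<close>

lemma norm_trunc_diff_le':
  assumes "0 < \<epsilon>" "\<epsilon> \<le> \<delta>" "\<delta> \<le> pi"
  shows "norm (trunc \<epsilon> \<alpha> - trunc \<delta> \<alpha>) \<le> 2 powr \<gamma> * pi * C * \<delta> powr \<gamma> / \<gamma>"
proof -
  have "2 powr \<gamma> * pi * C * (\<delta> powr \<gamma> - \<epsilon> powr \<gamma>) / \<gamma> \<le> 2 powr \<gamma> * pi * C * \<delta> powr \<gamma> / \<gamma>"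
    using \<gamma> C_nonneg by (intro divide_right_mono mult_left_mono) auto
  then show ?thesis using norm_trunc_diff_le[OF assms, of \<alpha>] by linarith
qed

lemma trunc_tendsto_hilbert:
  "((\<lambda>\<epsilon>. trunc \<epsilon> \<alpha>) \<longlongrightarrow> (2 * pi) *\<^sub>R hilbert \<phi> \<alpha>) (at_right 0)"
proof -
  let ?F = "filtermap (\<lambda>\<epsilon>. trunc \<epsilon> \<alpha>) (at_right 0)"
  have small: "((\<lambda>\<delta>. 2 powr \<gamma> * pi * C * \<delta> powr \<gamma> / \<gamma>) \<longlongrightarrow> 0) (at_right 0)"
    using \<gamma> by (auto intro!: tendsto_eq_intros eventually_at_rightI[of 0 1])
  \<comment> \<open>The cutoff tends to 0 along a filter and not along a sequence, so completeness
    is used for the image filter.\<close>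
  have "cauchy_filter ?F"
    unfolding cauchy_filter_metric
  proof (intro allI impI)
    fix e :: real assume "0 < e"
    with small have "\<forall>\<^sub>F \<delta> in at_right 0. 2 powr \<gamma> * pi * C * \<delta> powr \<gamma> / \<gamma> < e"
      by (simp add: order_tendstoD)
    moreover have "\<forall>\<^sub>F \<delta> in at_right (0::real). \<delta> \<in> {0<..<pi}"
      by (intro eventually_at_rightI[of 0 pi]) auto
    ultimately have "\<forall>\<^sub>F \<delta> in at_right 0. 2 powr \<gamma> * pi * C * \<delta> powr \<gamma> / \<gamma> < e \<and> \<delta> \<in> {0<..<pi}"
      by (rule eventually_conj)
    then obtain \<delta> where \<delta>: "2 powr \<gamma> * pi * C * \<delta> powr \<gamma> / \<gamma> < e" "0 < \<delta>" "\<delta> < pi"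
      using eventually_happens'[OF trivial_limit_at_right_real] by fastforce
    have *: "norm (trunc \<epsilon> \<alpha> - trunc \<epsilon>' \<alpha>) < e" if "0 < \<epsilon>" "\<epsilon> \<le> \<epsilon>'" "\<epsilon>' \<le> \<delta>" for \<epsilon> \<epsilon>'
    proof -
      have "2 powr \<gamma> * pi * C * \<epsilon>' powr \<gamma> / \<gamma> \<le> 2 powr \<gamma> * pi * C * \<delta> powr \<gamma> / \<gamma>"
        using that \<gamma> C_nonneg by (intro divide_right_mono mult_left_mono powr_mono2) auto
      then show ?thesis using norm_trunc_diff_le'[of \<epsilon> \<epsilon>' \<alpha>] that \<delta> by linarith
    qed
    have "dist (trunc \<epsilon> \<alpha>) (trunc \<epsilon>' \<alpha>) < e" if "\<epsilon> \<in> {0<..<\<delta>}" "\<epsilon>' \<in> {0<..<\<delta>}" for \<epsilon> \<epsilon>'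
      using *[of \<epsilon> \<epsilon>'] *[of \<epsilon>' \<epsilon>] that by (cases "\<epsilon> \<le> \<epsilon>'") (auto simp: dist_norm norm_minus_commute)
    moreover have "\<forall>\<^sub>F \<epsilon> in at_right 0. \<epsilon> \<in> {0<..<\<delta>}"
      using \<delta> by (intro eventually_at_rightI[of 0 \<delta>]) auto
    then have "\<forall>\<^sub>F x in ?F. x \<in> (\<lambda>\<epsilon>. trunc \<epsilon> \<alpha>) ` {0<..<\<delta>}"
      unfolding eventually_filtermap by (rule eventually_mono) auto
    ultimately show "\<exists>P. eventually P ?F \<and> (\<forall>x y. P x \<and> P y \<longrightarrow> dist x y < e)"
      by (intro exI[of _ "\<lambda>x. x \<in> (\<lambda>\<epsilon>. trunc \<epsilon> \<alpha>) ` {0<..<\<delta>}"])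
         blast
  qed
  then obtain L where "?F \<le> nhds L"
    using cauchy_filter_complete_converges[of ?F UNIV] complete_UNIV
    by (auto simp: filtermap_bot_iff)
  then have L: "((\<lambda>\<epsilon>. trunc \<epsilon> \<alpha>) \<longlongrightarrow> L) (at_right 0)"
    by (simp add: filterlim_def)
  have "\<forall>\<^sub>F \<epsilon> in at_right 0. trunc \<epsilon> \<alpha> =
      integral {-pi..-\<epsilon>} (\<lambda>t. \<phi> (\<alpha> - t) /\<^sub>R tan (t / 2)) +
      integral {\<epsilon>..pi} (\<lambda>t. \<phi> (\<alpha> - t) /\<^sub>R tan (t / 2))"
    by (rule eventually_at_rightI[of 0 pi]) (auto simp: hilbert_trunc)
  then have "((\<lambda>\<epsilon>. integral {-pi..-\<epsilon>} (\<lambda>t. \<phi> (\<alpha> - t) /\<^sub>R tan (t / 2)) +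
      integral {\<epsilon>..pi} (\<lambda>t. \<phi> (\<alpha> - t) /\<^sub>R tan (t / 2))) \<longlongrightarrow> L) (at_right 0)"
    using L by (rule Lim_transform_eventually[rotated])
  then have "hilbert \<phi> \<alpha> = (1 / (2 * pi)) *\<^sub>R L"
    by (simp add: hilbert_def tendsto_Lim)
  with L show ?thesis by simp
qed

text \<open>The smaller cutoff tends to 0 with \<delta> fixed. With \<delta> equal to the increment
  h the error has the desired order h^\<gamma>; with \<delta> = pi it bounds the transform
  itself.\<close>

lemma norm_trunc_minus_hilbert_le:
  assumes "0 < \<delta>" "\<delta> \<le> pi"
  shows "norm ((2 * pi) *\<^sub>R hilbert \<phi> \<alpha> - trunc \<delta> \<alpha>) \<le> 2 powr \<gamma> * pi * C * \<delta> powr \<gamma> / \<gamma>"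
proof (rule tendsto_upperbound)
  show "((\<lambda>\<epsilon>. norm (trunc \<epsilon> \<alpha> - trunc \<delta> \<alpha>)) \<longlongrightarrow> norm ((2 * pi) *\<^sub>R hilbert \<phi> \<alpha> - trunc \<delta> \<alpha>)) (at_right 0)"
    by (intro tendsto_intros trunc_tendsto_hilbert)
  show "\<forall>\<^sub>F \<epsilon> in at_right 0. norm (trunc \<epsilon> \<alpha> - trunc \<delta> \<alpha>) \<le> 2 powr \<gamma> * pi * C * \<delta> powr \<gamma> / \<gamma>"
    using assms by (intro eventually_at_rightI[of 0 \<delta>]) (auto intro: norm_trunc_diff_le')
qed auto


section \<open>Privalov's theorem\<close>

lemma trunc_minus_const:
  assumes "0 < \<epsilon>"
  shows "trunc \<epsilon> \<alpha> = integral {\<epsilon>..2 * pi - \<epsilon>} (\<lambda>t. cot (t / 2) *\<^sub>R (\<phi> (\<alpha> - t) - c))"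
proof -
  have i1: "(\<lambda>t. cot (t / 2) *\<^sub>R \<phi> (\<alpha> - t)) integrable_on {\<epsilon>..2 * pi - \<epsilon>}"
    and i2: "(\<lambda>t. cot (t / 2) :: real) integrable_on {\<epsilon>..2 * pi - \<epsilon>}"
    using assms by (intro integrable_continuous_interval continuous_intros; auto)+
  \<comment> \<open>The kernel is odd about pi and the truncated interval is symmetric about pi, so
    constants are annihilated already before the limit.\<close>
  have "integral {\<epsilon>..2 * pi - \<epsilon>} (\<lambda>t. cot (t / 2) :: real)
      = integral {\<epsilon>..2 * pi - \<epsilon>} (\<lambda>t. cot ((2 * pi - t) / 2))"
    by (subst integral_reflect_Icc) simp
  also have "(\<lambda>t. cot ((2 * pi - t) / 2)) = (\<lambda>t::real. - cot (t / 2))"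
    by (simp add: cot_def diff_divide_distrib sin_diff cos_diff)
  finally have "integral {\<epsilon>..2 * pi - \<epsilon>} (\<lambda>t. cot (t / 2) :: real) = 0" by simp
  moreover have "integral {\<epsilon>..2 * pi - \<epsilon>} (\<lambda>t. cot (t / 2) *\<^sub>R c)
      = integral {\<epsilon>..2 * pi - \<epsilon>} (\<lambda>t. cot (t / 2) :: real) *\<^sub>R c"
    using has_integral_scaleR_left[OF integrable_integral[OF i2], of c] by (rule integral_unique)
  moreover have "(\<lambda>t. cot (t / 2) *\<^sub>R c) integrable_on {\<epsilon>..2 * pi - \<epsilon>}"
    using has_integral_scaleR_left[OF integrable_integral[OF i2], of c] by blast
  ultimately show ?thesis
    using i1 by (simp add: trunc_def scaleR_diff_right integral_diff)
qed

text \<open>The truncated integrals at \<open>\<alpha>\<close> and \<open>\<alpha> + h\<close>, written over the same variable \<open>u\<close>, overlap on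
  \<open>[h, 2 pi - 2 h]\<close>; there the kernels differ by \<open>O(h / d\<^sup>2)\<close> where \<open>d\<close> is the distance of \<open>u\<close> to the
  singularities \<open>0\<close> and \<open>2 pi\<close>.  Subtracting \<open>\<phi> \<alpha>\<close> is free because the kernel has integral zero.\<close>

lemma norm_trunc_shift_le:
  assumes h: "0 < h" "h \<le> 2 * pi / 3"
  shows "norm (trunc h (\<alpha> + h) - trunc h \<alpha>) \<le> C * (3 * pi + 2 * pi\<^sup>2 / (1 - \<gamma>)) * h powr \<gamma>"
proof -
  define \<psi> where "\<psi> u = \<phi> (\<alpha> - u) - \<phi> \<alpha>" for u
  have cont: "continuous_on A \<psi>" for A
    unfolding \<psi>_def by (intro continuous_intros)
  have \<psi>1: "norm (\<psi> u) \<le> C * u powr \<gamma>" if "0 \<le> u" for u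
    using holder[of "\<alpha> - u" \<alpha>] that by (simp add: \<psi>_def)
  \<comment> \<open>By periodicity \<phi> \<alpha> is also the value at \<alpha> - 2 pi, so \<psi>
    vanishes at both singularities of the kernel.\<close>
  have \<psi>2: "norm (\<psi> u) \<le> C * (2 * pi - u) powr \<gamma>" if "u \<le> 2 * pi" for u
    using holder[of "\<alpha> - u" "\<alpha> - 2 * pi"] that by (simp add: \<psi>_def periodic')
  let ?f = "\<lambda>u. cot ((u + h) / 2) *\<^sub>R \<psi> u" and ?g = "\<lambda>u. cot (u / 2) *\<^sub>R \<psi> u"
  have contf: "continuous_on {0..2 * pi - 2 * h} ?f"
    using h by (intro continuous_on_scaleR cont
        continuous_on_compose2[OF continuous_cot_half[of "{0<..<2 * pi}"], of _ "\<lambda>u. u + h"]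
        continuous_intros) auto
  have contg: "continuous_on {h..2 * pi - h} ?g"
    using h cont by (intro continuous_intros) auto
  have intf: "?f integrable_on {0..2 * pi - 2 * h}" and intg: "?g integrable_on {h..2 * pi - h}"
    using contf contg by (auto intro: integrable_continuous_interval)
  \<comment> \<open>The substitution t = u + h transfers the shift from \<phi> to the kernel, so
    that both truncations integrate the same \<psi>.\<close>
  have "trunc h (\<alpha> + h) = integral {0 + h..(2 * pi - 2 * h) + h} (\<lambda>t. cot (t / 2) *\<^sub>R (\<phi> (\<alpha> + h - t) - \<phi> \<alpha>))"
    using h by (simp add: trunc_minus_const[where c = "\<phi> \<alpha>"] algebra_simps)
  also have "\<dots> = integral {0..2 * pi - 2 * h} ?f"
    unfolding integral_shift_Icc_real[symmetric] by (simp add: o_def \<psi>_def add.commute)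
  also have "\<dots> = integral {0..h} ?f + integral {h..2 * pi - 2 * h} ?f"
    using Henstock_Kurzweil_Integration.integral_combine[OF _ _ intf, of h] h by simp
  finally have f: "trunc h (\<alpha> + h) = \<dots>" .
  have "trunc h \<alpha> = integral {h..2 * pi - h} ?g"
    using h by (simp add: trunc_minus_const[where c = "\<phi> \<alpha>"] \<psi>_def)
  also have "\<dots> = integral {h..2 * pi - 2 * h} ?g + integral {2 * pi - 2 * h..2 * pi - h} ?g"
    using Henstock_Kurzweil_Integration.integral_combine[OF _ _ intg, of "2 * pi - 2 * h"] h by simp
  finally have g: "trunc h \<alpha> = \<dots>" .
  \<comment> \<open>A piece outside the overlap: kernel at most pi / h, \<psi> at most C h^\<gamma>,
    length h.\<close>
  have e1: "norm (integral {0..h} ?f) \<le> C * pi * h powr \<gamma>"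
  proof -
    have "norm (integral {0..h} ?f) \<le> (pi / h * (C * h powr \<gamma>)) * (h - 0)"
    proof (rule integral_bound)
      show "continuous_on {0..h} ?f"
        using h by (intro continuous_on_subset[OF contf]) auto
      show "norm (?f u) \<le> pi / h * (C * h powr \<gamma>)" if u: "u \<in> {0..h}" for u
      proof -
        have "\<bar>cot ((u + h) / 2)\<bar> \<le> pi / min (u + h) (2 * pi - (u + h))"
          using u h by (intro abs_cot_half_le) auto
        also have "\<dots> \<le> pi / h"
          using u h by (intro divide_left_mono) auto
        finally have "\<bar>cot ((u + h) / 2)\<bar> \<le> pi / h" .
        moreover have "norm (\<psi> u) \<le> C * h powr \<gamma>"
          using u \<gamma> C_nonneg by (intro order_trans[OF \<psi>1] mult_left_mono powr_mono2) auto
        ultimately show ?thesis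
          unfolding norm_scaleR by (intro mult_mono) (use h in auto)
      qed
    qed (use h in auto)
    then show ?thesis using h by (simp add: field_simps)
  qed
  have two: "2 powr \<gamma> \<le> 2"
    using \<gamma> powr_mono[of \<gamma> 1 2] by simp
  \<comment> \<open>Here u may be as far as 2 h from the singularity 2 pi; the resulting 2^\<gamma>
    is rounded up to 2.\<close>
  have e2: "norm (integral {2 * pi - 2 * h..2 * pi - h} ?g) \<le> 2 * C * pi * h powr \<gamma>"
  proof -
    have "norm (integral {2 * pi - 2 * h..2 * pi - h} ?g)
        \<le> (pi / h * (2 * C * h powr \<gamma>)) * ((2 * pi - h) - (2 * pi - 2 * h))"
    proof (rule integral_bound)
      show "continuous_on {2 * pi - 2 * h..2 * pi - h} ?g"
        using h by (intro continuous_on_subset[OF contg]) auto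
      show "norm (?g u) \<le> pi / h * (2 * C * h powr \<gamma>)" if u: "u \<in> {2 * pi - 2 * h..2 * pi - h}" for u
      proof -
        have "\<bar>cot (u / 2)\<bar> \<le> pi / min u (2 * pi - u)"
          using u h by (intro abs_cot_half_le) auto
        also have "\<dots> \<le> pi / h"
          using u h by (intro divide_left_mono) auto
        finally have "\<bar>cot (u / 2)\<bar> \<le> pi / h" .
        moreover have "norm (\<psi> u) \<le> C * (2 * h) powr \<gamma>"
          using u h \<gamma> C_nonneg by (intro order_trans[OF \<psi>2] mult_left_mono powr_mono2) auto
        then have "norm (\<psi> u) \<le> 2 * C * h powr \<gamma>"
          using mult_right_mono[OF mult_left_mono[OF two C_nonneg], of "h powr \<gamma>"] h
          by (simp add: powr_mult ac_simps)
        ultimately show ?thesis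
          unfolding norm_scaleR by (intro mult_mono) (use h in auto)
      qed
    qed (use h in auto)
    then show ?thesis using h by (simp add: field_simps)
  qed
  have e3: "norm (integral {h..2 * pi - 2 * h} ?f - integral {h..2 * pi - 2 * h} ?g)
      \<le> C * (2 * pi\<^sup>2 / (1 - \<gamma>)) * h powr \<gamma>"
  proof -
    let ?I = "{h..2 * pi - 2 * h}"
    let ?k = "C * pi\<^sup>2 * h"
    \<comment> \<open>The natural majorant is a multiple of d^(\<gamma> - 2) with d the smaller
      distance to a singularity. Adding the powers of both distances avoids cutting the integral at
      pi.\<close>
    let ?b = "\<lambda>u. ?k * (u powr (\<gamma> - 1 - 1) + (2 * pi - u) powr (\<gamma> - 1 - 1))"
    let ?v = "?k * (((2 * pi - 2 * h) powr (\<gamma> - 1) - h powr (\<gamma> - 1)) / (\<gamma> - 1)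
      + ((2 * pi - h) powr (\<gamma> - 1) - (2 * pi - (2 * pi - 2 * h)) powr (\<gamma> - 1)) / (\<gamma> - 1))"
    have fI: "?f integrable_on ?I" and gI: "?g integrable_on ?I"
      using h by (auto intro!: integrable_continuous_interval continuous_on_subset[OF contf]
          continuous_on_subset[OF contg])
    have b: "(?b has_integral ?v) ?I"
      using h \<gamma> by (intro has_integral_mult_right has_integral_add powr_has_integral
          powr_reflect_has_integral) auto
    have "norm (integral ?I (\<lambda>u. ?f u - ?g u)) \<le> integral ?I ?b"
    proof (rule Henstock_Kurzweil_Integration.integral_norm_bound_integral)
      show "(\<lambda>u. ?f u - ?g u) integrable_on ?I" using fI gI by (rule integrable_diff)
      show "?b integrable_on ?I" using b by blast
      fix u assume u: "u \<in> ?I"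
      define d where "d = min u (2 * pi - u)"
      \<comment> \<open>Since 2 pi - u is at least 2 h, moving from u to u + h at most halves the
        distance to the singularities. The factor 2 lost here cancels the 2 in the denominator of
        the smoothness estimate.\<close>
      have d: "0 < d" "d \<le> u" "d \<le> 2 * pi - u" and d2: "d \<le> 2 * min (u + h) (2 * pi - (u + h))"
        using u h by (auto simp: d_def min_def)
      have "\<bar>cot ((u + h) / 2) - cot (u / 2)\<bar>
          \<le> pi\<^sup>2 * \<bar>(u + h) - u\<bar> / (2 * min (u + h) (2 * pi - (u + h)) * d)"
        unfolding d_def using u h by (intro abs_cot_half_diff_le) auto
      also have "\<dots> \<le> pi\<^sup>2 * h / (d * d)"
        using d d2 h by (intro frac_le mult_right_mono) simp_all
      finally have k: "\<bar>cot ((u + h) / 2) - cot (u / 2)\<bar> \<le> pi\<^sup>2 * h / (d * d)" .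
      have "norm (\<psi> u) \<le> C * d powr \<gamma>"
        using \<psi>1[of u] \<psi>2[of u] u h by (auto simp: d_def min_def)
      with k have "norm (?f u - ?g u) \<le> pi\<^sup>2 * h / (d * d) * (C * d powr \<gamma>)"
        unfolding scaleR_diff_left[symmetric] norm_scaleR using h d by (intro mult_mono) auto
      also have "\<dots> = ?k * d powr (\<gamma> - 1 - 1)"
        using d by (simp add: powr_diff power2_eq_square mult_ac)
      also have "\<dots> \<le> ?b u"
        using h C_nonneg by (intro mult_left_mono) (auto simp: d_def min_def)
      finally show "norm (?f u - ?g u) \<le> ?b u" .
    qed
    also have "integral ?I ?b = ?v" using b by (rule integral_unique)
    \<comment> \<open>As \<gamma> - 1 is negative, the antiderivatives are largest at the ends near
      the singularities; the contributions of the far ends have a favourable sign and are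
      dropped.\<close>
    also have "\<dots> \<le> ?k * (h powr (\<gamma> - 1) / (1 - \<gamma>) + h powr (\<gamma> - 1) / (1 - \<gamma>))"
    proof (intro mult_left_mono add_mono)
      have *: "(x - y) / (\<gamma> - 1) \<le> z / (1 - \<gamma>)" if "0 \<le> x" "y \<le> z" for x y z :: real
      proof -
        have "(x - y) / (\<gamma> - 1) = (y - x) / (1 - \<gamma>)"
          using \<gamma> by (simp add: field_simps)
        also have "\<dots> \<le> z / (1 - \<gamma>)" using \<gamma> that by (intro divide_right_mono) auto
        finally show ?thesis .
      qed
      show "((2 * pi - 2 * h) powr (\<gamma> - 1) - h powr (\<gamma> - 1)) / (\<gamma> - 1) \<le> h powr (\<gamma> - 1) / (1 - \<gamma>)"
        by (intro *) auto
      show "((2 * pi - h) powr (\<gamma> - 1) - (2 * pi - (2 * pi - 2 * h)) powr (\<gamma> - 1)) / (\<gamma> - 1)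
          \<le> h powr (\<gamma> - 1) / (1 - \<gamma>)"
        using h \<gamma> by (intro * powr_mono2') auto
      show "0 \<le> ?k" using C_nonneg h by simp
    qed
    also have "\<dots> = C * (2 * pi\<^sup>2 / (1 - \<gamma>)) * (h * h powr (\<gamma> - 1))"
      by (simp add: mult_ac)
    also have "h * h powr (\<gamma> - 1) = h powr \<gamma>"
      using h by (simp add: powr_mult_base)
    finally show ?thesis using fI gI by (simp add: integral_diff)
  qed
  have "norm (trunc h (\<alpha> + h) - trunc h \<alpha>) = norm (integral {0..h} ?f
      - integral {2 * pi - 2 * h..2 * pi - h} ?g
      + (integral {h..2 * pi - 2 * h} ?f - integral {h..2 * pi - 2 * h} ?g))"
    unfolding f g by (simp add: algebra_simps)
  also have "\<dots> \<le> C * pi * h powr \<gamma> + 2 * C * pi * h powr \<gamma> + C * (2 * pi\<^sup>2 / (1 - \<gamma>)) * h powr \<gamma>"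
    by (intro order_trans[OF norm_triangle_ineq] add_mono order_trans[OF norm_triangle_ineq4] e1 e2 e3)
  finally show ?thesis by (simp add: algebra_simps)
qed

text \<open>The cutoff is chosen equal to the increment h. Two truncation errors, each at most 4 pi
  / \<gamma> times C h^\<gamma>, account for 8 pi / \<gamma>; the remaining terms come from the
  shift estimate. Beyond its range h <= 2 pi / 3 the transform is bounded outright, because
  \<open>trunc pi\<close> integrates over a single point. The final division by 2 pi is the
  normalization of \<open>hilbert\<close>.\<close>

lemma privalov:
  "norm (hilbert \<phi> s - hilbert \<phi> t)
    \<le> (8 * pi / \<gamma> + 3 * pi + 2 * pi\<^sup>2 / (1 - \<gamma>)) / (2 * pi) * C * \<bar>s - t\<bar> powr \<gamma>"
proof -
  let ?B = "8 * pi / \<gamma> + 3 * pi + 2 * pi\<^sup>2 / (1 - \<gamma>)"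
  have two: "2 powr \<gamma> \<le> 2"
    using \<gamma> powr_mono[of \<gamma> 1 2] by simp
  have *: "norm ((2 * pi) *\<^sub>R hilbert \<phi> (\<alpha> + h) - (2 * pi) *\<^sub>R hilbert \<phi> \<alpha>) \<le> ?B * C * h powr \<gamma>"
    if h: "0 < h" for \<alpha> h
  proof (cases "h \<le> 2 * pi / 3")
    case True
    let ?E = "2 powr \<gamma> * pi * C * h powr \<gamma> / \<gamma>"
    have "norm ((2 * pi) *\<^sub>R hilbert \<phi> (\<alpha> + h) - (2 * pi) *\<^sub>R hilbert \<phi> \<alpha>)
      = norm (((2 * pi) *\<^sub>R hilbert \<phi> (\<alpha> + h) - trunc h (\<alpha> + h)) - ((2 * pi) *\<^sub>R hilbert \<phi> \<alpha> - trunc h \<alpha>)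
          + (trunc h (\<alpha> + h) - trunc h \<alpha>))"
      by simp
    also have "\<dots> \<le> ?E + ?E + C * (3 * pi + 2 * pi\<^sup>2 / (1 - \<gamma>)) * h powr \<gamma>"
      using True h pi_gt_zero
      by (intro order_trans[OF norm_triangle_ineq] add_mono order_trans[OF norm_triangle_ineq4]
          norm_trunc_minus_hilbert_le norm_trunc_shift_le) auto
    also have "?E \<le> 4 * (pi * C * h powr \<gamma> / \<gamma>)"
    proof -
      have "2 powr \<gamma> * (pi * C * h powr \<gamma> / \<gamma>) \<le> 4 * (pi * C * h powr \<gamma> / \<gamma>)"
        using two C_nonneg \<gamma> by (intro mult_right_mono) auto
      then show ?thesis by (simp add: mult.assoc)
    qed
    finally show ?thesis by (simp add: algebra_simps)
  next
    case False
    let ?E = "2 powr \<gamma> * pi * C * pi powr \<gamma> / \<gamma>"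
    have "trunc pi \<beta> = 0" for \<beta> by (simp add: trunc_def)
    then have "norm ((2 * pi) *\<^sub>R hilbert \<phi> \<beta>) \<le> ?E" for \<beta>
      using norm_trunc_minus_hilbert_le[of pi \<beta>] by simp
    then have "norm ((2 * pi) *\<^sub>R hilbert \<phi> (\<alpha> + h) - (2 * pi) *\<^sub>R hilbert \<phi> \<alpha>) \<le> ?E + ?E"
      by (intro order_trans[OF norm_triangle_ineq4] add_mono)
    also have "?E \<le> 4 * (pi * C * h powr \<gamma> / \<gamma>)"
    proof -
      \<comment> \<open>Comparing pi with 2 h costs a second factor 2^\<gamma>, hence the constant 4
        that both cases share.\<close>
      have "pi \<le> 2 * h" using False pi_gt_zero by linarith
      then have "pi powr \<gamma> \<le> (2 * h) powr \<gamma>"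
        using \<gamma> by (intro powr_mono2) auto
      then have "2 powr \<gamma> * pi powr \<gamma> \<le> 2 powr \<gamma> * (2 powr \<gamma> * h powr \<gamma>)"
        using h by (simp add: powr_mult)
      also have "\<dots> \<le> 2 * (2 * h powr \<gamma>)"
        using two by (intro mult_mono) auto
      finally have "(2 powr \<gamma> * pi powr \<gamma>) * (pi * C / \<gamma>) \<le> (4 * h powr \<gamma>) * (pi * C / \<gamma>)"
        using C_nonneg \<gamma> by (intro mult_right_mono) auto
      then show ?thesis by (simp add: ac_simps)
    qed
    also have "4 * (pi * C * h powr \<gamma> / \<gamma>) + 4 * (pi * C * h powr \<gamma> / \<gamma>) \<le> ?B * C * h powr \<gamma>"
      using C_nonneg \<gamma> by (simp add: algebra_simps)
    finally show ?thesis by simp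
  qed
  have **: "norm (hilbert \<phi> (\<alpha> + h) - hilbert \<phi> \<alpha>) \<le> ?B / (2 * pi) * C * h powr \<gamma>"
    if "0 < h" for \<alpha> h
  proof -
    have "2 * pi * norm (hilbert \<phi> (\<alpha> + h) - hilbert \<phi> \<alpha>) \<le> ?B * C * h powr \<gamma>"
      using *[OF that, of \<alpha>] by (simp flip: scaleR_diff_right)
    then have "norm (hilbert \<phi> (\<alpha> + h) - hilbert \<phi> \<alpha>) \<le> (?B * C * h powr \<gamma>) / (2 * pi)"
      by (subst pos_le_divide_eq) (simp_all add: mult.commute)
    then show ?thesis by simp
  qed
  show ?thesis
    using **[of "s - t" t] **[of "t - s" s]
    by (cases s t rule: linorder_cases) (auto simp: norm_minus_commute abs_if)
qed

text \<open>Since \<open>1 / sin t = (cot (t / 2) + tan (t / 2)) / 2\<close> and \<open>tan (t / 2) = - cot ((t + pi) / 2)\<close>,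
  the kernel of the angular operator is a difference of two translated Hilbert kernels.\<close>

lemma K2_angular_trunc:
  fixes \<epsilon> \<alpha> :: real
  assumes \<epsilon>: "0 < \<epsilon>" "\<epsilon> < pi / 2"
  defines "g \<equiv> \<lambda>t. \<phi> (\<alpha> - t)"
  shows "integral {-pi + \<epsilon>..-\<epsilon>} (\<lambda>t. g t /\<^sub>R sin (- t)) + integral {\<epsilon>..pi - \<epsilon>} (\<lambda>t. g t /\<^sub>R sin (- t))
    = (1 / 2) *\<^sub>R (trunc \<epsilon> (\<alpha> + pi) - trunc \<epsilon> \<alpha>
       + (integral {-pi..-pi + \<epsilon>} (\<lambda>t. cot (t / 2) *\<^sub>R g t)
          + integral {pi - \<epsilon>..pi} (\<lambda>t. cot (t / 2) *\<^sub>R g t)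
          + integral {-\<epsilon>..\<epsilon>} (\<lambda>t. tan (t / 2) *\<^sub>R g t)))"
proof -
  let ?cot = "\<lambda>t. cot (t / 2) *\<^sub>R g t" and ?tan = "\<lambda>t. tan (t / 2) *\<^sub>R g t"
  have cg: "continuous_on A g" for A unfolding g_def by (intro continuous_intros)
  have "continuous_on {-pi..-\<epsilon>} (\<lambda>t. cot (t / 2) :: real)"
    unfolding cot_def
  proof (intro continuous_intros ballI)
    fix t assume "t \<in> {-pi..-\<epsilon>}"
    then show "sin (t / 2) \<noteq> 0" using sin_half_pos[of "- t"] \<epsilon> by auto
  qed auto
  then have c1: "?cot integrable_on {-pi..-\<epsilon>}"
    by (intro integrable_continuous_interval continuous_on_scaleR cg)
  have c2: "?cot integrable_on {\<epsilon>..pi}"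
    using \<epsilon> by (intro integrable_continuous_interval continuous_on_scaleR cg continuous_cot_half) auto
  have c3: "?tan integrable_on {-pi + \<epsilon>..pi - \<epsilon>}"
    using \<epsilon> cos_gt_zero_pi[of "t / 2" for t]
    by (intro integrable_continuous_interval continuous_on_scaleR cg continuous_intros)
       (auto simp: less_imp_neq[symmetric])
  note comb = Henstock_Kurzweil_Integration.integral_combine
  \<comment> \<open>The truncation of 1 / sin removes neighbourhoods of 0, pi and -pi alike. The
    cotangent is regular at pi and -pi and the tangent at 0, so the pieces restored here to complete
    the two Hilbert truncations are harmless.\<close>
  have cot1: "integral {-pi..-pi + \<epsilon>} ?cot + integral {-pi + \<epsilon>..-\<epsilon>} ?cot = integral {-pi..-\<epsilon>} ?cot"
    using \<epsilon> by (intro comb c1) auto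
  have cot2: "integral {\<epsilon>..pi - \<epsilon>} ?cot + integral {pi - \<epsilon>..pi} ?cot = integral {\<epsilon>..pi} ?cot"
    using \<epsilon> by (intro comb c2) auto
  have tan1: "integral {-pi + \<epsilon>..-\<epsilon>} ?tan + integral {-\<epsilon>..pi - \<epsilon>} ?tan = integral {-pi + \<epsilon>..pi - \<epsilon>} ?tan"
    using \<epsilon> by (intro comb c3) auto
  have tan2: "integral {-\<epsilon>..\<epsilon>} ?tan + integral {\<epsilon>..pi - \<epsilon>} ?tan = integral {-\<epsilon>..pi - \<epsilon>} ?tan"
    using \<epsilon> by (intro comb integrable_subinterval_real[OF c3]) auto
  have A: "trunc \<epsilon> \<alpha> = integral {-pi..-\<epsilon>} ?cot + integral {\<epsilon>..pi} ?cot"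
    using hilbert_trunc[of \<epsilon> \<alpha>] \<epsilon> by (simp add: g_def flip: cot_altdef)
  have "trunc \<epsilon> (\<alpha> + pi) = integral {-pi + \<epsilon> + pi..pi - \<epsilon> + pi} (\<lambda>t. cot (t / 2) *\<^sub>R \<phi> (\<alpha> + pi - t))"
    by (simp add: trunc_def)
  also have "\<dots> = integral {-pi + \<epsilon>..pi - \<epsilon>} (\<lambda>t. - ?tan t)"
    unfolding integral_shift_Icc_real[symmetric]
  proof (rule integral_cong)
    fix t
    have "cot ((pi + t) / 2) = - tan (t / 2)"
      by (simp add: cot_def tan_def add_divide_distrib sin_add cos_add)
    then show "((\<lambda>t. cot (t / 2) *\<^sub>R \<phi> (\<alpha> + pi - t)) \<circ> (+) pi) t = - ?tan t"
      by (simp add: g_def)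
  qed
  finally have B: "trunc \<epsilon> (\<alpha> + pi) = - integral {-pi + \<epsilon>..pi - \<epsilon>} ?tan" by simp
  \<comment> \<open>True at the singularities too: there one of cot and tan is a division by zero,
    the other is genuinely zero, and the left side is the inverse of 0.\<close>
  have csc: "inverse (sin (- t)) = - (1 / 2) * (cot (t / 2) + tan (t / 2))" for t :: real
  proof (cases "sin (t / 2) = 0 \<or> cos (t / 2) = 0")
    case True
    then show ?thesis using sin_double[of "t / 2"] by (auto simp: cot_def tan_def)
  next
    case False
    then show ?thesis using sin_double[of "t / 2"] sin_cos_squared_add2[of "t / 2"]
      by (simp add: cot_def tan_def add_frac_eq inverse_eq_divide power2_eq_square)
  qed
  have split: "integral I (\<lambda>t. g t /\<^sub>R sin (- t)) = - ((1 / 2) *\<^sub>R (integral I ?cot + integral I ?tan))"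
    if "?cot integrable_on I" "?tan integrable_on I" for I
  proof -
    have "(\<lambda>t. g t /\<^sub>R sin (- t)) = (\<lambda>t. - ((1 / 2) *\<^sub>R (?cot t + ?tan t)))"
      unfolding csc
      by (simp only: scaleR_scaleR[symmetric] scaleR_minus_left scaleR_add_left)
    then show ?thesis using that by (simp add: integral_add)
  qed
  have "integral {-pi + \<epsilon>..-\<epsilon>} (\<lambda>t. g t /\<^sub>R sin (- t))
      = - ((1 / 2) *\<^sub>R (integral {-pi + \<epsilon>..-\<epsilon>} ?cot + integral {-pi + \<epsilon>..-\<epsilon>} ?tan))"
    using \<epsilon> by (intro split integrable_subinterval_real[OF c1] integrable_subinterval_real[OF c3]) auto
  moreover have "integral {\<epsilon>..pi - \<epsilon>} (\<lambda>t. g t /\<^sub>R sin (- t))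
      = - ((1 / 2) *\<^sub>R (integral {\<epsilon>..pi - \<epsilon>} ?cot + integral {\<epsilon>..pi - \<epsilon>} ?tan))"
    using \<epsilon> by (intro split integrable_subinterval_real[OF c2] integrable_subinterval_real[OF c3]) auto
  ultimately show ?thesis
    unfolding A B cot1[symmetric] cot2[symmetric] tan1[symmetric] tan2[symmetric]
    by (simp add: algebra_simps)
qed

text \<open>The three correction integrals cover a total length of 4 \<epsilon>. For \<epsilon> < pi
  / 2 each stays at distance at least pi / 2 from the singularities of its kernel, which is
  therefore at most 2 there, and so the corrections vanish in the limit.\<close>

lemma K2_angular_tendsto:
  "((\<lambda>\<epsilon>. integral {-pi + \<epsilon>..-\<epsilon>} (\<lambda>t. \<phi> (\<alpha> - t) /\<^sub>R sin (- t)) +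
          integral {\<epsilon>..pi - \<epsilon>} (\<lambda>t. \<phi> (\<alpha> - t) /\<^sub>R sin (- t)))
     \<longlongrightarrow> pi *\<^sub>R (hilbert \<phi> (\<alpha> + pi) - hilbert \<phi> \<alpha>)) (at_right 0)"
proof -
  define g where "g = (\<lambda>t. \<phi> (\<alpha> - t))"
  let ?cot = "\<lambda>t. cot (t / 2) *\<^sub>R g t" and ?tan = "\<lambda>t. tan (t / 2) *\<^sub>R g t"
  define E where "E \<epsilon> = integral {-pi..-pi + \<epsilon>} ?cot + integral {pi - \<epsilon>..pi} ?cot
      + integral {-\<epsilon>..\<epsilon>} ?tan" for \<epsilon>
  have cg: "continuous_on A g" for A unfolding g_def by (intro continuous_intros)
  have "bounded (g ` {-pi..pi})"
    by (intro compact_imp_bounded compact_continuous_image cg) auto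
  then obtain M where M: "0 < M" "\<And>t. t \<in> {-pi..pi} \<Longrightarrow> norm (g t) \<le> M"
    by (auto simp: bounded_pos)
  have cot_le: "\<bar>cot (t / 2)\<bar> \<le> 2" if "pi / 2 \<le> t" "t \<le> pi" for t :: real
  proof -
    have "\<bar>cot (t / 2)\<bar> \<le> pi / min t (2 * pi - t)"
      using that pi_gt_zero by (intro abs_cot_half_le) linarith+
    also have "\<dots> \<le> pi / (pi / 2)"
      using that pi_gt_zero by (intro frac_le) (simp_all add: min_def)
    finally show ?thesis by simp
  qed
  have tan_le: "\<bar>tan (t / 2)\<bar> \<le> 2" if "\<bar>t\<bar> \<le> pi / 2" for t :: real
  proof -
    have "tan (t / 2) = cot ((pi - t) / 2)"
      by (simp add: tan_def cot_def diff_divide_distrib sin_diff cos_diff)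
    moreover have "\<bar>cot ((pi - t) / 2)\<bar> \<le> pi / min (pi - t) (2 * pi - (pi - t))"
      using that pi_gt_zero by (intro abs_cot_half_le) linarith+
    moreover have "\<dots> \<le> pi / (pi / 2)"
      using that pi_gt_zero by (intro frac_le) (auto simp: min_def abs_if split: if_splits)
    ultimately show ?thesis by simp
  qed
  have E_le: "norm (E \<epsilon>) \<le> 8 * M * \<epsilon>" if \<epsilon>: "0 < \<epsilon>" "\<epsilon> < pi / 2" for \<epsilon>
  proof -
    have "norm (integral {-pi..-pi + \<epsilon>} ?cot) \<le> 2 * M * ((-pi + \<epsilon>) - -pi)"
    proof (rule integral_bound)
      show "continuous_on {-pi..-pi + \<epsilon>} ?cot"
        unfolding cot_def
      proof (intro continuous_on_scaleR cg continuous_intros ballI)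
        fix t assume "t \<in> {-pi..-pi + \<epsilon>}"
        then show "sin (t / 2) \<noteq> 0" using sin_half_pos[of "- t"] \<epsilon> by auto
      qed auto
      show "norm (?cot t) \<le> 2 * M" if "t \<in> {-pi..-pi + \<epsilon>}" for t
        unfolding norm_scaleR using that \<epsilon> cot_le[of "- t"] M by (intro mult_mono) auto
    qed (use \<epsilon> in auto)
    moreover have "norm (integral {pi - \<epsilon>..pi} ?cot) \<le> 2 * M * (pi - (pi - \<epsilon>))"
    proof (rule integral_bound)
      show "continuous_on {pi - \<epsilon>..pi} ?cot"
        using \<epsilon> by (intro continuous_on_scaleR cg continuous_cot_half) auto
      show "norm (?cot t) \<le> 2 * M" if "t \<in> {pi - \<epsilon>..pi}" for t
        unfolding norm_scaleR using that \<epsilon> cot_le[of t] M by (intro mult_mono) auto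
    qed (use \<epsilon> in auto)
    moreover have "norm (integral {-\<epsilon>..\<epsilon>} ?tan) \<le> 2 * M * (\<epsilon> - -\<epsilon>)"
    proof (rule integral_bound)
      show "continuous_on {-\<epsilon>..\<epsilon>} ?tan"
        using \<epsilon> cos_gt_zero_pi[of "t / 2" for t]
        by (intro continuous_on_scaleR cg continuous_intros) (auto simp: less_imp_neq[symmetric])
      show "norm (?tan t) \<le> 2 * M" if "t \<in> {-\<epsilon>..\<epsilon>}" for t
        unfolding norm_scaleR using that \<epsilon> tan_le[of t] M by (intro mult_mono) auto
    qed (use \<epsilon> in auto)
    ultimately have "norm (E \<epsilon>) \<le> 2 * M * ((-pi + \<epsilon>) - -pi) + 2 * M * (pi - (pi - \<epsilon>)) + 2 * M * (\<epsilon> - -\<epsilon>)"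
      unfolding E_def by (intro order_trans[OF norm_triangle_ineq] add_mono)
    then show ?thesis by (simp add: algebra_simps)
  qed
  have "(E \<longlongrightarrow> 0) (at_right 0)"
  proof (rule Lim_null_comparison)
    show "\<forall>\<^sub>F \<epsilon> in at_right 0. norm (E \<epsilon>) \<le> 8 * M * \<epsilon>"
      by (rule eventually_at_rightI[of 0 "pi / 2"]) (auto intro: E_le)
    show "((\<lambda>\<epsilon>. 8 * M * \<epsilon>) \<longlongrightarrow> 0) (at_right 0)"
      by (auto intro!: tendsto_eq_intros)
  qed
  then have "((\<lambda>\<epsilon>. (1 / 2) *\<^sub>R (trunc \<epsilon> (\<alpha> + pi) - trunc \<epsilon> \<alpha> + E \<epsilon>))
      \<longlongrightarrow> (1 / 2) *\<^sub>R ((2 * pi) *\<^sub>R hilbert \<phi> (\<alpha> + pi) - (2 * pi) *\<^sub>R hilbert \<phi> \<alpha> + 0)) (at_right 0)"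
    by (intro tendsto_intros trunc_tendsto_hilbert)
  then have "((\<lambda>\<epsilon>. (1 / 2) *\<^sub>R (trunc \<epsilon> (\<alpha> + pi) - trunc \<epsilon> \<alpha> + E \<epsilon>))
      \<longlongrightarrow> pi *\<^sub>R (hilbert \<phi> (\<alpha> + pi) - hilbert \<phi> \<alpha>)) (at_right 0)"
    by (simp add: scaleR_diff_right)
  then show ?thesis
  proof (rule Lim_transform_eventually)
    show "\<forall>\<^sub>F \<epsilon> in at_right 0. (1 / 2) *\<^sub>R (trunc \<epsilon> (\<alpha> + pi) - trunc \<epsilon> \<alpha> + E \<epsilon>) =
        integral {-pi + \<epsilon>..-\<epsilon>} (\<lambda>t. \<phi> (\<alpha> - t) /\<^sub>R sin (- t)) +
        integral {\<epsilon>..pi - \<epsilon>} (\<lambda>t. \<phi> (\<alpha> - t) /\<^sub>R sin (- t))"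
      by (rule eventually_at_rightI[of 0 "pi / 2"])
         (use K2_angular_trunc[of _ \<alpha>] in \<open>simp_all add: E_def g_def\<close>)
  qed
qed

lemma K2_angular_eq: "K2_angular \<phi> \<alpha> = hilbert \<phi> (\<alpha> + pi) - hilbert \<phi> \<alpha>"
  unfolding K2_angular_def using tendsto_Lim[OF _ K2_angular_tendsto] by simp

end

section \<open>Completion of a semi-normed function space\<close>

locale seminormed_function_space =
  fixes V :: "('i \<Rightarrow> 'k::real_normed_field) set" and p :: "('i \<Rightarrow> 'k) \<Rightarrow> real"
  assumes function_space: "function_space V" and seminorm_on: "seminorm_on V p"
begin

lemma zero_mem: "(\<lambda>_. 0) \<in> V"
  and add_mem: "f \<in> V \<Longrightarrow> g \<in> V \<Longrightarrow> (\<lambda>i. f i + g i) \<in> V"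
  and scale_mem: "f \<in> V \<Longrightarrow> (\<lambda>i. c * f i) \<in> V"
  using function_space by (auto simp: function_space_def)

lemma diff_mem: "f \<in> V \<Longrightarrow> g \<in> V \<Longrightarrow> (\<lambda>i. f i - g i) \<in> V"
  using add_mem[OF _ scale_mem[of g "-1"]] by simp

lemma nonneg: "f \<in> V \<Longrightarrow> 0 \<le> p f"
  and triangle: "f \<in> V \<Longrightarrow> g \<in> V \<Longrightarrow> p (\<lambda>i. f i + g i) \<le> p f + p g"
  and scale: "f \<in> V \<Longrightarrow> p (\<lambda>i. c * f i) = norm c * p f"
  using seminorm_on by (auto simp: seminorm_on_def)

lemma zero: "p (\<lambda>_. 0) = 0"
  using scale[OF zero_mem, of 0] by simp

lemma minus_commute: "f \<in> V \<Longrightarrow> g \<in> V \<Longrightarrow> p (\<lambda>i. f i - g i) = p (\<lambda>i. g i - f i)"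
  using scale[OF diff_mem[of g f], of "-1"] by simp

lemma diff_triangle:
  assumes "f \<in> V" "g \<in> V" "h \<in> V"
  shows "p (\<lambda>i. f i - h i) \<le> p (\<lambda>i. f i - g i) + p (\<lambda>i. g i - h i)"
  using triangle[OF diff_mem[OF assms(1,2)] diff_mem[OF assms(2,3)]] by simp

lemma abs_diff_le:
  assumes "f \<in> V" "g \<in> V"
  shows "\<bar>p f - p g\<bar> \<le> p (\<lambda>i. f i - g i)"
  using triangle[OF assms(1) diff_mem[OF assms(2,1)]] triangle[OF assms(2) diff_mem[OF assms]]
    minus_commute[OF assms] by simp

abbreviation "cauchy \<equiv> cauchy_seqs V p"
abbreviation "cls \<equiv> seq_class V p"

lemma cauchy_mem: "u \<in> cauchy \<Longrightarrow> u n \<in> V"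
  by (auto simp: cauchy_seqs_def)

lemma cauchyI:
  "(\<And>n. u n \<in> V) \<Longrightarrow> (\<And>e. 0 < e \<Longrightarrow> \<exists>M. \<forall>m\<ge>M. \<forall>n\<ge>M. p (\<lambda>i. u m i - u n i) < e) \<Longrightarrow> u \<in> cauchy"
  by (auto simp: cauchy_seqs_def)

lemma cauchyD:
  "u \<in> cauchy \<Longrightarrow> 0 < e \<Longrightarrow> \<exists>M. \<forall>m\<ge>M. \<forall>n\<ge>M. p (\<lambda>i. u m i - u n i) < e"
  by (auto simp: cauchy_seqs_def)

lemma const_cauchy: "v \<in> V \<Longrightarrow> (\<lambda>_. v) \<in> cauchy"
  by (auto simp: cauchy_seqs_def zero)

lemma add_cauchy:
  assumes "u \<in> cauchy" "w \<in> cauchy"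
  shows "(\<lambda>n i. u n i + w n i) \<in> cauchy"
proof (rule cauchyI)
  note mem = cauchy_mem[OF assms(1)] cauchy_mem[OF assms(2)]
  show "(\<lambda>i. u n i + w n i) \<in> V" for n using mem by (intro add_mem)
  fix e :: real assume "0 < e"
  then obtain M N where M: "\<forall>m\<ge>M. \<forall>n\<ge>M. p (\<lambda>i. u m i - u n i) < e / 2"
    and N: "\<forall>m\<ge>N. \<forall>n\<ge>N. p (\<lambda>i. w m i - w n i) < e / 2"
    using cauchyD[OF assms(1), of "e / 2"] cauchyD[OF assms(2), of "e / 2"] by auto
  have "p (\<lambda>i. (u m i + w m i) - (u n i + w n i)) < e" if "m \<ge> max M N" "n \<ge> max M N" for m n
  proof -
    have "p (\<lambda>i. (u m i - u n i) + (w m i - w n i)) \<le> p (\<lambda>i. u m i - u n i) + p (\<lambda>i. w m i - w n i)"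
      by (intro triangle diff_mem mem)
    also have "\<dots> < e / 2 + e / 2"
      using M N that by (intro add_strict_mono) auto
    finally show ?thesis by (simp add: algebra_simps)
  qed
  then show "\<exists>M. \<forall>m\<ge>M. \<forall>n\<ge>M. p (\<lambda>i. (u m i + w m i) - (u n i + w n i)) < e" by blast
qed

lemma scale_cauchy:
  assumes "u \<in> cauchy"
  shows "(\<lambda>n i. c * u n i) \<in> cauchy"
proof (rule cauchyI)
  note mem = cauchy_mem[OF assms]
  show "(\<lambda>i. c * u n i) \<in> V" for n using mem by (intro scale_mem)
  fix e :: real assume e: "0 < e"
  have pos: "0 < norm c + 1" by (simp add: add_nonneg_pos)
  with e obtain M where M: "\<forall>m\<ge>M. \<forall>n\<ge>M. p (\<lambda>i. u m i - u n i) < e / (norm c + 1)"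
    using cauchyD[OF assms, of "e / (norm c + 1)"] by auto
  have "p (\<lambda>i. c * u m i - c * u n i) < e" if "m \<ge> M" "n \<ge> M" for m n
  proof -
    have "p (\<lambda>i. c * u m i - c * u n i) = norm c * p (\<lambda>i. u m i - u n i)"
      using scale[OF diff_mem[OF mem mem], of c m n] by (simp add: right_diff_distrib)
    also have "\<dots> \<le> (norm c + 1) * p (\<lambda>i. u m i - u n i)"
      using nonneg[OF diff_mem[OF mem mem]] by (intro mult_right_mono) auto
    also have "\<dots> < e"
      using M that pos by (simp add: pos_less_divide_eq mult.commute)
    finally show ?thesis .
  qed
  then show "\<exists>M. \<forall>m\<ge>M. \<forall>n\<ge>M. p (\<lambda>i. c * u m i - c * u n i) < e" by blast
qed

lemma mem_cls: "v \<in> cls u \<longleftrightarrow> v \<in> cauchy \<and> (\<lambda>n. p (\<lambda>i. u n i - v n i)) \<longlonglongrightarrow> 0"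
  by (auto simp: seq_class_def)

lemma self_mem_cls: "u \<in> cauchy \<Longrightarrow> u \<in> cls u"
  by (simp add: mem_cls zero)

lemma null_trans:
  assumes "u \<in> cauchy" "v \<in> cauchy" "w \<in> cauchy"
    and "(\<lambda>n. p (\<lambda>i. u n i - v n i)) \<longlonglongrightarrow> 0" "(\<lambda>n. p (\<lambda>i. v n i - w n i)) \<longlonglongrightarrow> 0"
  shows "(\<lambda>n. p (\<lambda>i. u n i - w n i)) \<longlonglongrightarrow> 0"
proof (rule tendsto_sandwich[of "\<lambda>_. 0"])
  show "(\<lambda>n. p (\<lambda>i. u n i - v n i) + p (\<lambda>i. v n i - w n i)) \<longlonglongrightarrow> 0"
    using tendsto_add[OF assms(4,5)] by simp
qed (use assms in \<open>auto intro!: always_eventually nonneg[OF diff_mem[OF cauchy_mem cauchy_mem]]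
      diff_triangle[OF cauchy_mem cauchy_mem cauchy_mem]\<close>)

lemma cls_eqI:
  assumes "u \<in> cauchy" "v \<in> cauchy" "(\<lambda>n. p (\<lambda>i. u n i - v n i)) \<longlonglongrightarrow> 0"
  shows "cls u = cls v"
proof -
  have "(\<lambda>n. p (\<lambda>i. v n i - u n i)) \<longlonglongrightarrow> 0"
    using assms by (subst minus_commute) (auto intro: cauchy_mem)
  with assms show ?thesis by (auto simp: mem_cls intro: null_trans)
qed

text \<open>Changing representatives alters the sum by a null sequence, so the defining union is
  over copies of one class.\<close>

lemma completion_add_cls:
  assumes "u \<in> cauchy" "w \<in> cauchy"
  shows "completion_add V p (cls u) (cls w) = cls (\<lambda>n i. u n i + w n i)"
proof -
  have "cls (\<lambda>n i. u' n i + w' n i) = cls (\<lambda>n i. u n i + w n i)"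
    if "u' \<in> cls u" "w' \<in> cls w" for u' w'
  proof (rule sym, rule cls_eqI)
    have c: "u' \<in> cauchy" "w' \<in> cauchy" using that by (auto simp: mem_cls)
    show "(\<lambda>n. p (\<lambda>i. (u n i + w n i) - (u' n i + w' n i))) \<longlonglongrightarrow> 0"
    proof (rule tendsto_sandwich[of "\<lambda>_. 0"])
      show "(\<lambda>n. p (\<lambda>i. u n i - u' n i) + p (\<lambda>i. w n i - w' n i)) \<longlonglongrightarrow> 0"
        using that tendsto_add[of _ 0 _ _ 0] by (auto simp: mem_cls)
      have "p (\<lambda>i. (u n i - u' n i) + (w n i - w' n i)) \<le> p (\<lambda>i. u n i - u' n i) + p (\<lambda>i. w n i - w' n i)" for n
        using assms c by (intro triangle diff_mem cauchy_mem)
      then show "\<forall>\<^sub>F n in sequentially. p (\<lambda>i. (u n i + w n i) - (u' n i + w' n i))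
          \<le> p (\<lambda>i. u n i - u' n i) + p (\<lambda>i. w n i - w' n i)"
        by (simp add: algebra_simps)
    qed (use assms c in \<open>auto intro!: always_eventually
        nonneg[OF diff_mem[OF add_mem[OF cauchy_mem cauchy_mem] add_mem[OF cauchy_mem cauchy_mem]]]\<close>)
  qed (use assms that in \<open>auto simp: mem_cls intro: add_cauchy\<close>)
  then show ?thesis
    using assms unfolding completion_add_def by (blast dest: self_mem_cls)
qed

lemma completion_scale_cls:
  assumes "u \<in> cauchy"
  shows "completion_scale V p c (cls u) = cls (\<lambda>n i. c * u n i)"
proof -
  have "cls (\<lambda>n i. c * u' n i) = cls (\<lambda>n i. c * u n i)" if "u' \<in> cls u" for u'
  proof (rule sym, rule cls_eqI)
    have c: "u' \<in> cauchy" using that by (auto simp: mem_cls)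
    have "p (\<lambda>i. c * u n i - c * u' n i) = norm c * p (\<lambda>i. u n i - u' n i)" for n
      using scale[OF diff_mem[OF cauchy_mem[OF assms] cauchy_mem[OF c]], of c n n]
      by (simp add: right_diff_distrib)
    then show "(\<lambda>n. p (\<lambda>i. c * u n i - c * u' n i)) \<longlonglongrightarrow> 0"
      using that by (auto simp: mem_cls intro: tendsto_mult_right_zero)
  qed (use assms that in \<open>auto simp: mem_cls intro: scale_cauchy\<close>)
  then show ?thesis
    using assms unfolding completion_scale_def by (blast dest: self_mem_cls)
qed

lemma completionE:
  assumes "U \<in> cauchy_completion V p"
  obtains u where "u \<in> cauchy" "U = cls u"
  using assms by (auto simp: cauchy_completion_def)

lemma cls_mem_completion: "u \<in> cauchy \<Longrightarrow> cls u \<in> cauchy_completion V p"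
  by (simp add: cauchy_completion_def)

lemma embed_mem_completion: "v \<in> V \<Longrightarrow> completion_embed V p v \<in> cauchy_completion V p"
  unfolding completion_embed_def by (intro cls_mem_completion const_cauchy)

text \<open>By the reverse triangle inequality the norms along a Cauchy sequence are Cauchy, and
  equivalent sequences share their limit. Only this makes the \<open>THE\<close> in
  \<open>completion_norm\<close> denote.\<close>

lemma completion_norm_cls:
  assumes "u \<in> cauchy"
  shows "(\<lambda>n. p (u n)) \<longlonglongrightarrow> completion_norm p (cls u)"
proof -
  have "Cauchy (\<lambda>n. p (u n))"
    unfolding Cauchy_def dist_real_def
  proof (intro allI impI)
    fix e :: real assume "0 < e"
    with cauchyD[OF assms] obtain M where "\<forall>m\<ge>M. \<forall>n\<ge>M. p (\<lambda>i. u m i - u n i) < e" by blast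
    then show "\<exists>M. \<forall>m\<ge>M. \<forall>n\<ge>M. \<bar>p (u m) - p (u n)\<bar> < e"
      using abs_diff_le[OF cauchy_mem[OF assms] cauchy_mem[OF assms]] by (meson le_less_trans)
  qed
  then obtain l where l: "(\<lambda>n. p (u n)) \<longlonglongrightarrow> l"
    by (auto simp: convergent_eq_Cauchy[symmetric])
  have *: "(\<lambda>n. p (v n)) \<longlonglongrightarrow> l" if "v \<in> cls u" for v
  proof -
    from that have v: "v \<in> cauchy" "(\<lambda>n. p (\<lambda>i. u n i - v n i)) \<longlonglongrightarrow> 0" by (auto simp: mem_cls)
    have "(\<lambda>n. p (u n) - p (v n)) \<longlonglongrightarrow> 0"
      by (rule Lim_null_comparison[OF always_eventually v(2)])
         (auto intro: abs_diff_le cauchy_mem assms v(1))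
    from tendsto_diff[OF l this] show ?thesis by simp
  qed
  have "completion_norm p (cls u) = l"
    unfolding completion_norm_def
    by (rule the_equality) (use * self_mem_cls[OF assms] LIMSEQ_unique[OF _ l] in blast)+
  with l show ?thesis by simp
qed

lemma completion_norm_nonneg:
  assumes "U \<in> cauchy_completion V p"
  shows "0 \<le> completion_norm p U"
  using assms
proof (rule completionE)
  fix u assume "u \<in> cauchy" "U = cls u"
  then show ?thesis
    using LIMSEQ_le_const[OF completion_norm_cls] nonneg cauchy_mem by metis
qed

lemma completion_add_mem:
  "U \<in> cauchy_completion V p \<Longrightarrow> W \<in> cauchy_completion V p
    \<Longrightarrow> completion_add V p U W \<in> cauchy_completion V p"
  by (elim completionE) (simp add: completion_add_cls cls_mem_completion add_cauchy)

lemma completion_scale_mem: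
  "U \<in> cauchy_completion V p \<Longrightarrow> completion_scale V p c U \<in> cauchy_completion V p"
  by (elim completionE) (simp add: completion_scale_cls cls_mem_completion scale_cauchy)

lemma embed_add:
  "v \<in> V \<Longrightarrow> w \<in> V \<Longrightarrow> completion_embed V p (\<lambda>i. v i + w i) =
     completion_add V p (completion_embed V p v) (completion_embed V p w)"
  unfolding completion_embed_def by (simp add: completion_add_cls const_cauchy)

text \<open>Density of the original space, needed for uniqueness of the extension. For fixed n the
  norm of the difference is the limit over m of the distances between the n-th and the m-th
  member.\<close>

lemma embed_tendsto:
  assumes "u \<in> cauchy"
  shows "(\<lambda>n. completion_norm p (completion_add V p (completion_embed V p (u n))
           (completion_scale V p (- 1) (cls u)))) \<longlonglongrightarrow> 0"
proof (rule LIMSEQ_I)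
  fix e :: real assume "0 < e"
  with cauchyD[OF assms, of "e / 2"]
  obtain M where M: "\<forall>m\<ge>M. \<forall>n\<ge>M. p (\<lambda>i. u m i - u n i) < e / 2" by auto
  let ?D = "\<lambda>n. completion_add V p (completion_embed V p (u n)) (completion_scale V p (- 1) (cls u))"
  note mem = cauchy_mem[OF assms]
  have D: "?D n \<in> cauchy_completion V p" for n
    using assms mem by (intro completion_add_mem completion_scale_mem embed_mem_completion cls_mem_completion)
  \<comment> \<open>Strict inequality is lost in the limit, hence e / 2 in place of e.\<close>
  have "completion_norm p (?D n) \<le> e / 2" if "n \<ge> M" for n
  proof (rule LIMSEQ_le_const2)
    have "?D n = cls (\<lambda>m i. u n i + - 1 * u m i)"
      unfolding completion_embed_def
      by (simp only: completion_scale_cls completion_add_cls const_cauchy scale_cauchy assms mem)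
    moreover have "(\<lambda>m. p (\<lambda>i. u n i + - 1 * u m i)) \<longlonglongrightarrow> completion_norm p (cls (\<lambda>m i. u n i + - 1 * u m i))"
      by (intro completion_norm_cls add_cauchy const_cauchy scale_cauchy assms mem)
    ultimately show "(\<lambda>m. p (\<lambda>i. u n i - u m i)) \<longlonglongrightarrow> completion_norm p (?D n)" by simp
    show "\<exists>N. \<forall>m\<ge>N. p (\<lambda>i. u n i - u m i) \<le> e / 2"
      using M that by (intro exI[of _ M]) (auto intro: less_imp_le)
  qed
  then have "norm (completion_norm p (?D n) - 0) < e" if "n \<ge> M" for n
    using completion_norm_nonneg[OF D, of n] that \<open>0 < e\<close> by force
  then show "\<exists>N. \<forall>n\<ge>N. norm (completion_norm p (?D n) - 0) < e" by blast
qed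

end

text \<open>The chosen representative is irrelevant when evaluation at \<open>i\<close> is bounded.\<close>

definition completion_value :: "(nat \<Rightarrow> 'i \<Rightarrow> 'k::real_normed_field) set \<Rightarrow> 'i \<Rightarrow> 'k" where
  "completion_value U i = lim (\<lambda>n. (SOME u. u \<in> U) n i)"

text \<open>The continuous functionals of interest are all evaluations at a point. For tensors,
  which are functions of bilinear forms, the point will be a bounded bilinear form.\<close>

locale bounded_evaluation = seminormed_function_space V p
  for V :: "('i \<Rightarrow> 'k::{real_normed_field, banach}) set" and p +
  fixes i :: 'i and c :: real
  assumes bound: "v \<in> V \<Longrightarrow> norm (v i) \<le> c * p v"
begin

lemma value_tendsto:
  assumes u: "u \<in> cauchy"
  shows "(\<lambda>n. u n i) \<longlonglongrightarrow> completion_value (cls u) i"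
proof -
  define v where "v = (SOME v. v \<in> cls u)"
  have v: "v \<in> cauchy" "(\<lambda>n. p (\<lambda>i. u n i - v n i)) \<longlonglongrightarrow> 0"
    using someI[of "\<lambda>v. v \<in> cls u", OF self_mem_cls[OF u]] by (auto simp: v_def mem_cls)
  have "Cauchy (\<lambda>n. v n i)"
    unfolding Cauchy_def dist_norm
  proof (intro allI impI)
    fix e :: real assume e: "0 < e"
    \<comment> \<open>The locale fixes no sign for c; this factor is positive and dominates
      it.\<close>
    have pos: "0 < \<bar>c\<bar> + 1" by simp
    with e obtain M where M: "\<forall>m\<ge>M. \<forall>n\<ge>M. p (\<lambda>i. v m i - v n i) < e / (\<bar>c\<bar> + 1)"
      using cauchyD[OF v(1), of "e / (\<bar>c\<bar> + 1)"] by auto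
    have "norm (v m i - v n i) < e" if "m \<ge> M" "n \<ge> M" for m n
    proof -
      note d = diff_mem[OF cauchy_mem[OF v(1), of m] cauchy_mem[OF v(1), of n]]
      have "norm (v m i - v n i) \<le> c * p (\<lambda>i. v m i - v n i)"
        using bound[OF d] .
      also have "\<dots> \<le> (\<bar>c\<bar> + 1) * p (\<lambda>i. v m i - v n i)"
        using nonneg[OF d] by (intro mult_right_mono) auto
      also have "\<dots> < e"
        using M that pos by (simp add: pos_less_divide_eq mult.commute)
      finally show ?thesis .
    qed
    then show "\<exists>M. \<forall>m\<ge>M. \<forall>n\<ge>M. norm (v m i - v n i) < e" by blast
  qed
  then have "(\<lambda>n. v n i) \<longlonglongrightarrow> completion_value (cls u) i"
    unfolding completion_value_def v_def[symmetric]
    by (simp add: Cauchy_convergent convergent_LIMSEQ_iff[symmetric])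
  moreover have "(\<lambda>n. u n i - v n i) \<longlonglongrightarrow> 0"
  proof (rule Lim_null_comparison)
    show "(\<lambda>n. c * p (\<lambda>i. u n i - v n i)) \<longlonglongrightarrow> 0"
      using v(2) by (rule tendsto_mult_right_zero)
    show "\<forall>\<^sub>F n in sequentially. norm (u n i - v n i) \<le> c * p (\<lambda>i. u n i - v n i)"
      using bound[OF diff_mem] cauchy_mem[OF u] cauchy_mem[OF v(1)] by (intro always_eventually) blast
  qed
  ultimately show ?thesis using tendsto_add[of _ 0 _ "\<lambda>n. v n i"] by fastforce
qed

lemma value_eqI: "u \<in> cauchy \<Longrightarrow> (\<lambda>n. u n i) \<longlonglongrightarrow> l \<Longrightarrow> completion_value (cls u) i = l"
  using LIMSEQ_unique[OF value_tendsto] by blast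

lemma value_add:
  assumes "U \<in> cauchy_completion V p" "W \<in> cauchy_completion V p"
  shows "completion_value (completion_add V p U W) i = completion_value U i + completion_value W i"
  using assms
  by (elim completionE) (auto simp: completion_add_cls intro!: value_eqI add_cauchy tendsto_add value_tendsto)

lemma value_scale:
  assumes "U \<in> cauchy_completion V p"
  shows "completion_value (completion_scale V p a U) i = a * completion_value U i"
  using assms
  by (elim completionE) (auto simp: completion_scale_cls intro!: value_eqI scale_cauchy tendsto_mult_left value_tendsto)

lemma value_embed: "v \<in> V \<Longrightarrow> completion_value (completion_embed V p v) i = v i"
  unfolding completion_embed_def by (intro value_eqI const_cauchy) auto

lemma norm_value_le:
  assumes "U \<in> cauchy_completion V p"
  shows "norm (completion_value U i) \<le> c * completion_norm p U"
  using assms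
proof (rule completionE)
  fix u assume u: "u \<in> cauchy" "U = cls u"
  have "(\<lambda>n. norm (u n i)) \<longlonglongrightarrow> norm (completion_value U i)"
    unfolding u(2) by (intro tendsto_norm value_tendsto u(1))
  moreover have "(\<lambda>n. c * p (u n)) \<longlonglongrightarrow> c * completion_norm p U"
    unfolding u(2) by (intro tendsto_mult_left completion_norm_cls u(1))
  ultimately show ?thesis
    by (rule LIMSEQ_le) (use bound cauchy_mem[OF u(1)] in blast)
qed

end

section \<open>The projective tensor product\<close>

lemma sum_lessThan_add:
  fixes f :: "nat \<Rightarrow> 'b::comm_monoid_add"
  shows "(\<Sum>i<n + m. f i) = (\<Sum>i<n. f i) + (\<Sum>i<m. f (n + i))"
  by (induction m) (auto simp: ac_simps)

locale projective_tensor =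
  L: seminormed_function_space X p + R: seminormed_function_space Y q
  for X :: "('s \<Rightarrow> 'k::real_normed_field) set" and p and Y :: "('t \<Rightarrow> 'k) set" and q +
  fixes E :: "('s \<Rightarrow> 'k) \<Rightarrow> ('s \<Rightarrow> 'k) \<Rightarrow> bool"
begin

abbreviation "tensor_sum n x y \<equiv> (\<lambda>B. \<Sum>i<(n::nat). elem_tensor E X Y (x i) (y i) B)"
abbreviation "legal n x y \<equiv> (\<forall>i<(n::nat). x i \<in> X \<and> y i \<in> Y)"
abbreviation "cost n x y \<equiv> (\<Sum>i<(n::nat). p (x i) * q (y i))"
abbreviation "V \<equiv> alg_tensor E X Y"
abbreviation "\<pi>norm \<equiv> proj_norm E X p Y q"

lemma tensor_sum_mem: "legal n x y \<Longrightarrow> tensor_sum n x y \<in> V"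
  unfolding alg_tensor_def by blast

lemma alg_tensorE:
  assumes "u \<in> V"
  obtains n x y where "legal n x y" "u = tensor_sum n x y"
  using assms unfolding alg_tensor_def by blast

lemma elem_tensor_mem:
  assumes "x \<in> X" "y \<in> Y"
  shows "elem_tensor E X Y x y \<in> V"
  using tensor_sum_mem[of 1 "\<lambda>_. x" "\<lambda>_. y"] assms by simp

lemma cost_nonneg: "legal n x y \<Longrightarrow> 0 \<le> cost n x y"
  by (auto intro!: sum_nonneg mult_nonneg_nonneg L.nonneg R.nonneg)

lemma proj_norm_le: "legal n x y \<Longrightarrow> \<pi>norm (tensor_sum n x y) \<le> cost n x y"
  unfolding proj_norm_def
  by (rule cInf_lower) (blast, rule bdd_belowI[of _ 0], use cost_nonneg in blast)

lemma proj_norm_greatest: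
  assumes "u \<in> V" "\<And>n x y. legal n x y \<Longrightarrow> u = tensor_sum n x y \<Longrightarrow> r \<le> cost n x y"
  shows "r \<le> \<pi>norm u"
  unfolding proj_norm_def
  by (rule cInf_greatest) (use assms in \<open>auto elim!: alg_tensorE\<close>)

lemma proj_norm_approx:
  assumes "u \<in> V" "0 < e"
  obtains n x y where "legal n x y" "u = tensor_sum n x y" "cost n x y < \<pi>norm u + e"
proof -
  have "\<exists>n x y. legal n x y \<and> u = tensor_sum n x y \<and> cost n x y < \<pi>norm u + e"
  proof (rule ccontr)
    assume "\<not> ?thesis"
    then have "\<pi>norm u + e \<le> \<pi>norm u"
      using assms(1) by (intro proj_norm_greatest) (auto simp: not_less)
    with assms(2) show False by simp
  qed
  with that show thesis by blast
qed

lemma proj_norm_nonneg: "u \<in> V \<Longrightarrow> 0 \<le> \<pi>norm u"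
  by (intro proj_norm_greatest cost_nonneg)

text \<open>Concatenating two representations adds the tensors and their costs; the triangle
  inequality for the projective norm follows by taking nearly optimal representations.\<close>

lemma tensor_sum_add:
  assumes "legal n x y" "legal m x' y'"
  obtains x'' y'' where "legal (n + m) x'' y''"
    "tensor_sum (n + m) x'' y'' = (\<lambda>B. tensor_sum n x y B + tensor_sum m x' y' B)"
    "cost (n + m) x'' y'' = cost n x y + cost m x' y'"
proof
  let ?x = "\<lambda>i. if i < n then x i else x' (i - n)" and ?y = "\<lambda>i. if i < n then y i else y' (i - n)"
  show "legal (n + m) ?x ?y" using assms by auto
  show "tensor_sum (n + m) ?x ?y = (\<lambda>B. tensor_sum n x y B + tensor_sum m x' y' B)"
    "cost (n + m) ?x ?y = cost n x y + cost m x' y'"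
    by (simp_all add: sum_lessThan_add)
qed

lemma elem_tensor_scale:
  "x \<in> X \<Longrightarrow> y \<in> Y \<Longrightarrow> elem_tensor E X Y (\<lambda>s. c * x s) y B = c * elem_tensor E X Y x y B"
  by (auto simp: elem_tensor_def bilinear_forms_def)

lemma tensor_sum_scale:
  assumes "legal n x y"
  shows "legal n (\<lambda>i s. c * x i s) y"
    and "tensor_sum n (\<lambda>i s. c * x i s) y = (\<lambda>B. c * tensor_sum n x y B)"
    and "cost n (\<lambda>i s. c * x i s) y = norm c * cost n x y"
proof -
  show "legal n (\<lambda>i s. c * x i s) y" using assms by (auto intro: L.scale_mem)
  show "tensor_sum n (\<lambda>i s. c * x i s) y = (\<lambda>B. c * tensor_sum n x y B)"
    using assms by (auto simp: sum_distrib_left elem_tensor_scale intro!: sum.cong)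
  show "cost n (\<lambda>i s. c * x i s) y = norm c * cost n x y"
    using assms by (auto simp: sum_distrib_left L.scale mult.assoc intro!: sum.cong)
qed

lemma function_space_alg_tensor: "function_space V"
  unfolding function_space_def
proof (intro conjI ballI allI)
  show "(\<lambda>_. 0) \<in> V" using tensor_sum_mem[of 0] by simp
  fix u assume u: "u \<in> V"
  then obtain n x y where u': "legal n x y" "u = tensor_sum n x y" by (rule alg_tensorE)
  show "(\<lambda>B. c * u B) \<in> V" for c
    unfolding u'(2) using tensor_sum_mem[OF tensor_sum_scale(1)[OF u'(1)], of c]
    by (simp only: tensor_sum_scale(2)[OF u'(1)])
  fix v assume "v \<in> V"
  then obtain m x' y' where v': "legal m x' y'" "v = tensor_sum m x' y'" by (rule alg_tensorE)
  obtain x'' y'' where w: "legal (n + m) x'' y''"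
    "tensor_sum (n + m) x'' y'' = (\<lambda>B. tensor_sum n x y B + tensor_sum m x' y' B)"
    using tensor_sum_add[OF u'(1) v'(1)] .
  show "(\<lambda>B. u B + v B) \<in> V"
    unfolding u'(2) v'(2) w(2)[symmetric] using w(1) by (rule tensor_sum_mem)
qed

lemma proj_norm_add:
  assumes "u \<in> V" "v \<in> V"
  shows "\<pi>norm (\<lambda>B. u B + v B) \<le> \<pi>norm u + \<pi>norm v"
proof (rule field_le_epsilon)
  fix e :: real assume "0 < e"
  then have e: "0 < e / 2" by simp
  obtain n x y where u: "legal n x y" "u = tensor_sum n x y" "cost n x y < \<pi>norm u + e / 2"
    using proj_norm_approx[OF assms(1) e] .
  obtain m x' y' where v: "legal m x' y'" "v = tensor_sum m x' y'" "cost m x' y' < \<pi>norm v + e / 2"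
    using proj_norm_approx[OF assms(2) e] .
  obtain x'' y'' where w: "legal (n + m) x'' y''"
    "tensor_sum (n + m) x'' y'' = (\<lambda>B. u B + v B)"
    "cost (n + m) x'' y'' = cost n x y + cost m x' y'"
    using tensor_sum_add[OF u(1) v(1)] unfolding u(2) v(2) .
  show "\<pi>norm (\<lambda>B. u B + v B) \<le> \<pi>norm u + \<pi>norm v + e"
    using proj_norm_le[OF w(1)] w(2,3) u(3) v(3) by simp
qed

lemma proj_norm_scale_le:
  assumes "u \<in> V"
  shows "\<pi>norm (\<lambda>B. c * u B) \<le> norm c * \<pi>norm u"
proof (rule field_le_epsilon)
  fix e :: real assume e: "0 < e"
  \<comment> \<open>The added 1 keeps the tolerance well defined for c = 0.\<close>
  have pos: "0 < norm c + 1" by (simp add: add_nonneg_pos)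
  with e have "0 < e / (norm c + 1)" by simp
  from proj_norm_approx[OF assms this]
  obtain n x y where u: "legal n x y" "u = tensor_sum n x y" "cost n x y < \<pi>norm u + e / (norm c + 1)" .
  have "\<pi>norm (\<lambda>B. c * u B) \<le> norm c * cost n x y"
    using proj_norm_le[OF tensor_sum_scale(1)[OF u(1), of c]] tensor_sum_scale(2,3)[OF u(1), of c] u(2)
    by simp
  also have "\<dots> \<le> norm c * (\<pi>norm u + e / (norm c + 1))"
    using u(3) by (intro mult_left_mono) auto
  also have "\<dots> \<le> norm c * \<pi>norm u + e"
    using e pos by (simp add: distrib_left field_simps)
  finally show "\<pi>norm (\<lambda>B. c * u B) \<le> norm c * \<pi>norm u + e" .
qed

text \<open>Scaling a representation gives one inequality; the same inequality for the inverse
  scalar gives the other.\<close>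

lemma proj_norm_scale:
  assumes "u \<in> V"
  shows "\<pi>norm (\<lambda>B. c * u B) = norm c * \<pi>norm u"
proof (cases "c = 0")
  case True
  then show ?thesis
    using proj_norm_scale_le[OF assms, of c] proj_norm_nonneg[of "\<lambda>B. c * u B"] function_space_alg_tensor
    by (simp add: function_space_def)
next
  case False
  have "(\<lambda>B. c * u B) \<in> V"
    using assms function_space_alg_tensor by (auto simp: function_space_def)
  from proj_norm_scale_le[OF this, of "inverse c"] False
  have "\<pi>norm u \<le> inverse (norm c) * \<pi>norm (\<lambda>B. c * u B)"
    by (simp add: norm_inverse mult.assoc[symmetric])
  with False have "norm c * \<pi>norm u \<le> \<pi>norm (\<lambda>B. c * u B)"
    by (simp add: field_simps)
  with proj_norm_scale_le[OF assms, of c] show ?thesis by simp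
qed

sublocale tensor: seminormed_function_space V \<pi>norm
  by unfold_locales
     (auto simp: seminorm_on_def proj_norm_nonneg proj_norm_add proj_norm_scale function_space_alg_tensor)

text \<open>The bounded half of the universal property: the value at B depends on the tensor alone,
  so the termwise bound holds for every representation and passes to the infimum of the costs. This
  passage divides by c, which is why c = 0 is separate.\<close>

lemma bilinear_form_bound:
  assumes B: "B \<in> bilinear_forms E X Y" and c: "0 \<le> c"
    and le: "\<And>x y. x \<in> X \<Longrightarrow> y \<in> Y \<Longrightarrow> norm (B x y) \<le> c * (p x * q y)"
    and u: "u \<in> V"
  shows "norm (u B) \<le> c * \<pi>norm u"
proof -
  have *: "norm (u B) \<le> c * cost n x y" if "legal n x y" "u = tensor_sum n x y" for n x y
  proof -
    have "u B = (\<Sum>i<n. B (x i) (y i))"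
      unfolding that(2) using B by (simp add: elem_tensor_def)
    then have "norm (u B) \<le> (\<Sum>i<n. norm (B (x i) (y i)))"
      by (simp add: norm_sum)
    also have "\<dots> \<le> (\<Sum>i<n. c * (p (x i) * q (y i)))"
      using that(1) by (intro sum_mono le) auto
    finally show ?thesis by (simp add: sum_distrib_left)
  qed
  show ?thesis
  proof (cases "c = 0")
    case True
    from u obtain n x y where "legal n x y" "u = tensor_sum n x y" by (rule alg_tensorE)
    from *[OF this] True show ?thesis by simp
  next
    case False
    with c have pos: "0 < c" by simp
    have "norm (u B) / c \<le> \<pi>norm u"
    proof (rule proj_norm_greatest[OF u])
      fix n x y assume "legal n x y" "u = tensor_sum n x y"
      from *[OF this] show "norm (u B) / c \<le> cost n x y"
        using pos by (simp only: pos_divide_le_eq mult.commute)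
    qed
    with pos show ?thesis by (simp add: pos_divide_le_eq mult.commute)
  qed
qed

text \<open>Presents the empty sum as an elementary tensor, the only shape on which
  \<open>is_K2\<close> prescribes values.\<close>

lemma zero_tensor: "elem_tensor E X Y (\<lambda>_. 0) (\<lambda>_. 0) = (\<lambda>B. 0)"
  using elem_tensor_scale[OF L.zero_mem R.zero_mem, of 0] by auto

end

section \<open>Hoelder and integrable functions\<close>

lemma operator_norm_nonneg:
  assumes "0 \<le> C" "\<And>x. x \<in> X \<Longrightarrow> q (T x) \<le> C * p x"
  shows "0 \<le> operator_norm X p q T"
  unfolding operator_norm_def by (rule cInf_greatest) (use assms in auto)

lemma operator_norm_le:
  assumes "0 \<le> C" "\<And>x. x \<in> X \<Longrightarrow> q (T x) \<le> C * p x"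
  shows "operator_norm X p q T \<le> C"
  unfolding operator_norm_def
  by (rule cInf_lower) (use assms in \<open>auto intro!: bdd_belowI[of _ 0]\<close>)

text \<open>Once some constant is admissible, so is the infimum: divide by p x if it is positive; if
  it is 0, the admissible constant already forces the claim.\<close>

lemma operator_norm_apply:
  assumes "0 \<le> C" "\<And>x. x \<in> X \<Longrightarrow> q (T x) \<le> C * p x" and "x \<in> X" "0 \<le> p x"
  shows "q (T x) \<le> operator_norm X p q T * p x"
proof (cases "p x = 0")
  case True
  then show ?thesis using assms(2)[OF assms(3)] by simp
next
  case False
  with assms(4) have pos: "0 < p x" by simp
  have "q (T x) / p x \<le> operator_norm X p q T"
    unfolding operator_norm_def
    by (rule cInf_greatest) (use assms(1-3) pos in \<open>auto simp: pos_divide_le_eq\<close>)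
  with pos show ?thesis by (simp add: pos_divide_le_eq)
qed

lemma Holder_seminorm_le:
  assumes "\<And>s t. norm (f s - f t) \<le> C * \<bar>s - t\<bar> powr \<gamma>"
  shows "Holder_seminorm \<gamma> f \<le> C"
  unfolding Holder_seminorm_def
proof (rule cSup_least)
  have "norm (f 1 - f 0) / \<bar>1 - 0 :: real\<bar> powr \<gamma>
      \<in> {norm (f s - f t) / \<bar>s - t\<bar> powr \<gamma> | s t. s \<noteq> t}"
    by (intro CollectI exI[of _ 1] exI[of _ 0]) auto
  then show "{norm (f s - f t) / \<bar>s - t\<bar> powr \<gamma> | s t. s \<noteq> t} \<noteq> {}" by blast
qed (use assms in \<open>auto simp: pos_divide_le_eq\<close>)

text \<open>The assumed bound serves only to make the quotients bounded above, without which
  \<open>Sup\<close> says nothing; its constant C disappears from the conclusion.\<close>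

lemma Holder_seminorm_ge:
  assumes "\<And>s t. norm (f s - f t) \<le> C * \<bar>s - t\<bar> powr \<gamma>"
  shows "norm (f s - f t) \<le> Holder_seminorm \<gamma> f * \<bar>s - t\<bar> powr \<gamma>"
proof (cases "s = t")
  case False
  have "norm (f s - f t) / \<bar>s - t\<bar> powr \<gamma> \<le> Holder_seminorm \<gamma> f"
    unfolding Holder_seminorm_def
  proof (rule cSup_upper)
    show "bdd_above {norm (f s - f t) / \<bar>s - t\<bar> powr \<gamma> | s t. s \<noteq> t}"
      by (rule bdd_aboveI[of _ C]) (use assms in \<open>auto simp: pos_divide_le_eq\<close>)
  qed (use False in auto)
  with False show ?thesis by (simp add: pos_divide_le_eq)
qed simp

lemma HolderD: "f \<in> Holder \<gamma> \<Longrightarrow> norm (f s - f t) \<le> Holder_seminorm \<gamma> f * \<bar>s - t\<bar> powr \<gamma>"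
  unfolding Holder_def using Holder_seminorm_ge by blast

lemma Holder_seminorm_nonneg: "f \<in> Holder \<gamma> \<Longrightarrow> 0 \<le> Holder_seminorm \<gamma> f"
  using order_trans[OF norm_ge_zero HolderD[of f \<gamma> 1 0]] by simp

lemma holder_function_Holder:
  fixes f :: "real \<Rightarrow> 'k::{real_normed_field, banach}"
  assumes "0 < \<gamma>" "\<gamma> < 1" "f \<in> Holder \<gamma>"
  shows "holder_function f \<gamma> (Holder_seminorm \<gamma> f)"
  using assms HolderD[OF assms(3)] by unfold_locales (auto simp: Holder_def periodic_def)

lemma Holder_add_bound:
  assumes "f \<in> Holder \<gamma>" "g \<in> Holder \<gamma>"
  shows "norm ((f s + g s) - (f t + g t)) \<le> (Holder_seminorm \<gamma> f + Holder_seminorm \<gamma> g) * \<bar>s - t\<bar> powr \<gamma>"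
proof -
  have "norm ((f s - f t) + (g s - g t)) \<le> Holder_seminorm \<gamma> f * \<bar>s - t\<bar> powr \<gamma> + Holder_seminorm \<gamma> g * \<bar>s - t\<bar> powr \<gamma>"
    by (intro order_trans[OF norm_triangle_ineq] add_mono HolderD assms)
  then show ?thesis by (simp add: algebra_simps)
qed

lemma Holder_scale_bound:
  assumes "f \<in> Holder \<gamma>"
  shows "norm (c * f s - c * f t) \<le> (norm c * Holder_seminorm \<gamma> f) * \<bar>s - t\<bar> powr \<gamma>"
proof -
  have "norm (c * f s - c * f t) = norm c * norm (f s - f t)"
    by (simp flip: norm_mult right_diff_distrib)
  also have "\<dots> \<le> norm c * (Holder_seminorm \<gamma> f * \<bar>s - t\<bar> powr \<gamma>)"
    by (intro mult_left_mono HolderD assms) auto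
  finally show ?thesis by (simp add: mult.assoc)
qed

lemma Holder_seminorm_scale:
  assumes "f \<in> Holder \<gamma>"
  shows "Holder_seminorm \<gamma> (\<lambda>t. c * f t) = norm c * Holder_seminorm \<gamma> f"
proof (rule antisym)
  show "Holder_seminorm \<gamma> (\<lambda>t. c * f t) \<le> norm c * Holder_seminorm \<gamma> f"
    by (rule Holder_seminorm_le) (rule Holder_scale_bound[OF assms])
  show "norm c * Holder_seminorm \<gamma> f \<le> Holder_seminorm \<gamma> (\<lambda>t. c * f t)"
  proof (cases "c = 0")
    case True
    then show ?thesis
      using Holder_seminorm_ge[OF Holder_scale_bound[OF assms, of c], of 1 0] by simp
  next
    case False
    have "norm (f s - f t) \<le> (Holder_seminorm \<gamma> (\<lambda>t. c * f t) / norm c) * \<bar>s - t\<bar> powr \<gamma>" for s t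
    proof -
      have "norm c * norm (f s - f t) \<le> Holder_seminorm \<gamma> (\<lambda>t. c * f t) * \<bar>s - t\<bar> powr \<gamma>"
        using Holder_seminorm_ge[OF Holder_scale_bound[OF assms, of c], of s t]
        by (simp flip: norm_mult right_diff_distrib)
      with False show ?thesis by (simp add: field_simps)
    qed
    from Holder_seminorm_le[OF this] False show ?thesis by (simp add: field_simps)
  qed
qed

lemma Holder_even_subset: "f \<in> Holder_even \<gamma> \<Longrightarrow> f \<in> Holder \<gamma>"
  by (simp add: Holder_even_def)

lemma Holder_even_space:
  "seminormed_function_space (Holder_even \<gamma> :: (real \<Rightarrow> 'k::real_normed_field) set) (Holder_seminorm \<gamma>)"
proof
  have add: "(\<lambda>t. f t + g t) \<in> Holder \<gamma>" if "f \<in> Holder \<gamma>" "g \<in> Holder \<gamma>" for f g :: "real \<Rightarrow> 'k"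
    using that Holder_add_bound[OF that] by (auto simp: Holder_def periodic_def)
  have scale: "(\<lambda>t. c * f t) \<in> Holder \<gamma>" if "f \<in> Holder \<gamma>" for c and f :: "real \<Rightarrow> 'k"
    using that Holder_scale_bound[OF that] by (auto simp: Holder_def periodic_def)
  have "(\<lambda>_. 0) \<in> (Holder \<gamma> :: (real \<Rightarrow> 'k) set)"
    by (auto simp: Holder_def periodic_def intro: exI[of _ 0])
  with add scale show "function_space (Holder_even \<gamma> :: (real \<Rightarrow> 'k) set)"
    by (auto simp: function_space_def Holder_even_def)
  show "seminorm_on (Holder_even \<gamma> :: (real \<Rightarrow> 'k) set) (Holder_seminorm \<gamma>)"
    unfolding seminorm_on_def
    by (auto dest!: Holder_even_subset intro: Holder_seminorm_nonneg Holder_seminorm_scale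
        intro!: Holder_seminorm_le Holder_add_bound)
qed

lemma L1_half_space:
  "seminormed_function_space
     (L1_half :: (real \<Rightarrow> 'k::{real_normed_field, banach, second_countable_topology}) set) L1_half_norm"
proof
  show "function_space (L1_half :: (real \<Rightarrow> 'k) set)"
    by (auto simp: function_space_def L1_half_def)
  show "seminorm_on (L1_half :: (real \<Rightarrow> 'k) set) L1_half_norm"
    unfolding seminorm_on_def L1_half_def L1_half_norm_def
  proof (intro conjI ballI allI; clarify?)
    fix f g :: "real \<Rightarrow> 'k" assume fg: "integrable (lebesgue_on {0..}) f" "integrable (lebesgue_on {0..}) g"
    have "(LINT x|lebesgue_on {0..}. norm (f x + g x)) \<le> (LINT x|lebesgue_on {0..}. norm (f x) + norm (g x))"
      using fg by (intro integral_mono) (auto intro: norm_triangle_ineq)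
    with fg show "(LINT x|lebesgue_on {0..}. norm (f x + g x))
        \<le> (LINT x|lebesgue_on {0..}. norm (f x)) + (LINT x|lebesgue_on {0..}. norm (g x))"
      by simp
  qed (auto simp: norm_mult)
qed

section \<open>The operator on the completed tensor product\<close>

context
  fixes \<gamma> :: real
  assumes \<gamma>: "0 < \<gamma>" "\<gamma> < 1"
begin

text \<open>The constant is chosen before f, as required for the set in \<open>operator_norm\<close>
  to be nonempty.\<close>

lemma hilbert_bounded:
  "\<exists>C\<ge>0. \<forall>f \<in> (Holder \<gamma> :: (real \<Rightarrow> 'k::{real_normed_field, banach}) set).
     Holder_seminorm \<gamma> (hilbert f) \<le> C * Holder_seminorm \<gamma> f"
proof (intro exI conjI ballI)
  let ?C = "(8 * pi / \<gamma> + 3 * pi + 2 * pi\<^sup>2 / (1 - \<gamma>)) / (2 * pi)"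
  show "0 \<le> ?C" using \<gamma> by simp
  fix f :: "real \<Rightarrow> 'k" assume f: "f \<in> Holder \<gamma>"
  then interpret holder_function f \<gamma> "Holder_seminorm \<gamma> f"
    by (intro holder_function_Holder \<gamma>)
  show "Holder_seminorm \<gamma> (hilbert f) \<le> ?C * Holder_seminorm \<gamma> f"
    by (rule Holder_seminorm_le) (rule privalov)
qed

text \<open>The type argument names the scalar field, which the real value alone would not
  determine.\<close>

abbreviation hilbert_norm :: "'k::{real_normed_field, banach} itself \<Rightarrow> real" where
  "hilbert_norm _ \<equiv> operator_norm (Holder \<gamma>) (Holder_seminorm \<gamma>) (Holder_seminorm \<gamma>)
    (hilbert :: (real \<Rightarrow> 'k) \<Rightarrow> real \<Rightarrow> 'k)"

lemma hilbert_norm_nonneg: "0 \<le> hilbert_norm TYPE('k::{real_normed_field, banach})"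
proof -
  obtain C where "0 \<le> C" "\<forall>f \<in> (Holder \<gamma> :: (real \<Rightarrow> 'k) set).
      Holder_seminorm \<gamma> (hilbert f) \<le> C * Holder_seminorm \<gamma> f"
    using hilbert_bounded[where 'k = 'k] by blast
  then show ?thesis by (intro operator_norm_nonneg) auto
qed

text \<open>\<open>privalov\<close> enters twice, each time only for finiteness: of the semi-norm of
  the transform and of the operator norm. The bound that remains carries the sharp constant.\<close>

lemma norm_hilbert_diff_le:
  fixes f :: "real \<Rightarrow> 'k::{real_normed_field, banach}"
  assumes f: "f \<in> Holder \<gamma>"
  shows "norm (hilbert f s - hilbert f t)
    \<le> hilbert_norm TYPE('k) * Holder_seminorm \<gamma> f * \<bar>s - t\<bar> powr \<gamma>"
proof -
  interpret holder_function f \<gamma> "Holder_seminorm \<gamma> f"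
    by (intro holder_function_Holder \<gamma> f)
  obtain C where C: "0 \<le> C" "\<forall>f \<in> (Holder \<gamma> :: (real \<Rightarrow> 'k) set).
      Holder_seminorm \<gamma> (hilbert f) \<le> C * Holder_seminorm \<gamma> f"
    using hilbert_bounded[where 'k = 'k] by blast
  have "norm (hilbert f s - hilbert f t) \<le> Holder_seminorm \<gamma> (hilbert f) * \<bar>s - t\<bar> powr \<gamma>"
    by (rule Holder_seminorm_ge) (rule privalov)
  also have "\<dots> \<le> (hilbert_norm TYPE('k) * Holder_seminorm \<gamma> f) * \<bar>s - t\<bar> powr \<gamma>"
    by (intro mult_right_mono operator_norm_apply[where T = hilbert and p = "Holder_seminorm \<gamma>"
        and q = "Holder_seminorm \<gamma>", OF C(1) bspec[OF C(2)]] f Holder_seminorm_nonneg) auto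
  finally show ?thesis .
qed

text \<open>\<open>Lim\<close> is not additive in general. Additivity holds for the truncations,
  whose integrands are continuous, and reaches the transforms through convergence and uniqueness of
  limits.\<close>

lemma hilbert_add:
  fixes f g :: "real \<Rightarrow> 'k::{real_normed_field, banach}"
  assumes "f \<in> Holder \<gamma>" "g \<in> Holder \<gamma>"
  shows "hilbert (\<lambda>t. f t + g t) \<alpha> = hilbert f \<alpha> + hilbert g \<alpha>"
proof -
  interpret f: holder_function f \<gamma> "Holder_seminorm \<gamma> f"
    by (intro holder_function_Holder \<gamma> assms)
  interpret g: holder_function g \<gamma> "Holder_seminorm \<gamma> g"
    by (intro holder_function_Holder \<gamma> assms)
  interpret s: holder_function "\<lambda>t. f t + g t" \<gamma> "Holder_seminorm \<gamma> f + Holder_seminorm \<gamma> g"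
    using \<gamma> Holder_add_bound[OF assms] f.periodic g.periodic by unfold_locales auto
  have "f.trunc \<epsilon> \<alpha> + g.trunc \<epsilon> \<alpha> = s.trunc \<epsilon> \<alpha>" if "0 < \<epsilon>" for \<epsilon>
  proof -
    have "(\<lambda>t. cot (t / 2) *\<^sub>R f (\<alpha> - t)) integrable_on {\<epsilon>..2 * pi - \<epsilon>}"
      "(\<lambda>t. cot (t / 2) *\<^sub>R g (\<alpha> - t)) integrable_on {\<epsilon>..2 * pi - \<epsilon>}"
      using that by (intro integrable_continuous_interval continuous_intros continuous_cot_half
          f.continuous_compose g.continuous_compose; auto)+
    then show ?thesis
      by (simp add: f.trunc_def g.trunc_def s.trunc_def scaleR_add_right integral_add)
  qed
  then have "\<forall>\<^sub>F \<epsilon> in at_right 0. f.trunc \<epsilon> \<alpha> + g.trunc \<epsilon> \<alpha> = s.trunc \<epsilon> \<alpha>"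
    by (intro eventually_at_rightI[of 0 1]) auto
  then have "((\<lambda>\<epsilon>. s.trunc \<epsilon> \<alpha>) \<longlongrightarrow> (2 * pi) *\<^sub>R hilbert f \<alpha> + (2 * pi) *\<^sub>R hilbert g \<alpha>) (at_right 0)"
    by (rule Lim_transform_eventually[rotated])
       (intro tendsto_add f.trunc_tendsto_hilbert g.trunc_tendsto_hilbert)
  from tendsto_unique[OF _ this s.trunc_tendsto_hilbert]
  have "(2 * pi) *\<^sub>R (hilbert f \<alpha> + hilbert g \<alpha>) = (2 * pi) *\<^sub>R hilbert (\<lambda>t. f t + g t) \<alpha>"
    by (simp add: scaleR_add_right)
  then show ?thesis by simp
qed

lemma hilbert_scale:
  fixes f :: "real \<Rightarrow> 'k::{real_normed_field, banach}"
  assumes "f \<in> Holder \<gamma>"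
  shows "hilbert (\<lambda>t. c * f t) \<alpha> = c * hilbert f \<alpha>"
proof -
  interpret f: holder_function f \<gamma> "Holder_seminorm \<gamma> f"
    by (intro holder_function_Holder \<gamma> assms)
  interpret s: holder_function "\<lambda>t. c * f t" \<gamma> "norm c * Holder_seminorm \<gamma> f"
    using \<gamma> Holder_scale_bound[OF assms] f.periodic by unfold_locales auto
  have "c * f.trunc \<epsilon> \<alpha> = s.trunc \<epsilon> \<alpha>" if "0 < \<epsilon>" for \<epsilon>
  proof -
    have "(\<lambda>t. cot (t / 2) *\<^sub>R f (\<alpha> - t)) integrable_on {\<epsilon>..2 * pi - \<epsilon>}"
      using that by (intro integrable_continuous_interval continuous_intros continuous_cot_half
          f.continuous_compose) auto
    from has_integral_mult_right[OF integrable_integral[OF this], of c, THEN integral_unique]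
    show ?thesis by (simp add: f.trunc_def s.trunc_def)
  qed
  then have "\<forall>\<^sub>F \<epsilon> in at_right 0. c * f.trunc \<epsilon> \<alpha> = s.trunc \<epsilon> \<alpha>"
    by (intro eventually_at_rightI[of 0 1]) auto
  then have "((\<lambda>\<epsilon>. s.trunc \<epsilon> \<alpha>) \<longlongrightarrow> c * ((2 * pi) *\<^sub>R hilbert f \<alpha>)) (at_right 0)"
    by (rule Lim_transform_eventually[rotated]) (intro tendsto_mult_left f.trunc_tendsto_hilbert)
  from tendsto_unique[OF _ this s.trunc_tendsto_hilbert]
  have "(2 * pi) *\<^sub>R (c * hilbert f \<alpha>) = (2 * pi) *\<^sub>R hilbert (\<lambda>t. c * f t) \<alpha>" by simp
  then show ?thesis by simp
qed

lemma K2_angular_hilbert: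
  fixes f :: "real \<Rightarrow> 'k::{real_normed_field, banach}"
  assumes "f \<in> Holder \<gamma>"
  shows "K2_angular f \<alpha> = hilbert f (\<alpha> + pi) - hilbert f \<alpha>"
proof -
  interpret holder_function f \<gamma> "Holder_seminorm \<gamma> f"
    by (intro holder_function_Holder \<gamma> assms)
  show ?thesis by (rule K2_angular_eq)
qed

lemma continuous_K2_angular:
  fixes f :: "real \<Rightarrow> 'k::{real_normed_field, banach}"
  assumes f: "f \<in> Holder \<gamma>"
  shows "continuous_on UNIV (K2_angular f)"
proof -
  have c: "continuous_on UNIV (hilbert f)"
    using \<gamma>(1) norm_hilbert_diff_le[OF f] by (rule continuous_on_Holder_bound)
  have "continuous_on UNIV (\<lambda>\<alpha>. hilbert f (\<alpha> + pi) - hilbert f \<alpha>)"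
    by (intro continuous_intros c continuous_on_compose2[OF c]) auto
  then show ?thesis by (simp add: K2_angular_hilbert[OF f] cong: continuous_on_cong)
qed

lemma norm_K2_angular_le:
  fixes f :: "real \<Rightarrow> 'k::{real_normed_field, banach}"
  assumes f: "f \<in> Holder \<gamma>"
  shows "norm (K2_angular f \<alpha>)
    \<le> (inverse \<gamma> * pi powr (\<gamma> - 1) + hilbert_norm TYPE('k) * (2 * pi) powr \<gamma>) * Holder_seminorm \<gamma> f"
proof -
  have "norm (K2_angular f \<alpha>) \<le> hilbert_norm TYPE('k) * Holder_seminorm \<gamma> f * pi powr \<gamma>"
    using norm_hilbert_diff_le[OF f, of "\<alpha> + pi" \<alpha>] by (simp add: K2_angular_hilbert[OF f])
  \<comment> \<open>The two arguments of the transform are pi apart; enlarging pi to 2 pi and adding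
    a nonnegative term leads to the stated constant.\<close>
  also have "\<dots> \<le> hilbert_norm TYPE('k) * Holder_seminorm \<gamma> f * (2 * pi) powr \<gamma>"
    using \<gamma> by (intro mult_left_mono powr_mono2 mult_nonneg_nonneg hilbert_norm_nonneg
        Holder_seminorm_nonneg f) auto
  also have "\<dots> \<le> inverse \<gamma> * pi powr (\<gamma> - 1) * Holder_seminorm \<gamma> f
      + hilbert_norm TYPE('k) * Holder_seminorm \<gamma> f * (2 * pi) powr \<gamma>"
    using \<gamma> Holder_seminorm_nonneg[OF f] by simp
  finally show ?thesis by (simp add: algebra_simps)
qed

end

lemma K2_angular_periodic:
  assumes "periodic f"
  shows "K2_angular f (\<alpha> + 2 * pi) = K2_angular f \<alpha>"
proof -
  have "f (\<alpha> + 2 * pi - t) = f (\<alpha> - t)" for t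
  proof -
    have "\<alpha> + 2 * pi - t = (\<alpha> - t) + 2 * pi" by simp
    with assms show ?thesis unfolding periodic_def by metis
  qed
  then show ?thesis by (simp only: K2_angular_def)
qed

section \<open>Construction and boundedness of the operator\<close>

locale K2_setting =
  fixes \<gamma> :: real
    and F :: "(real \<Rightarrow> 'k::{real_normed_field, banach, second_countable_topology}) set"
    and normF :: "(real \<Rightarrow> 'k) \<Rightarrow> real"
  assumes \<gamma>: "0 < \<gamma>" "\<gamma> < 1"
    and lattice: "periodic_banach_lattice F normF"
    and constants: "(\<lambda>_. c) \<in> F"
begin

sublocale F: seminormed_function_space F normF
  using lattice by unfold_locales (auto simp: periodic_banach_lattice_def)

sublocale T: projective_tensor L1_half L1_half_norm "Holder_even \<gamma> :: (real \<Rightarrow> 'k) set"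
    "Holder_seminorm \<gamma>" ae_eq_half
  unfolding projective_tensor_def using L1_half_space Holder_even_space by blast

definition c\<^sub>\<gamma> :: real where
  "c\<^sub>\<gamma> = inverse \<gamma> * pi powr (\<gamma> - 1) + operator_norm (Holder \<gamma>) (Holder_seminorm \<gamma>) (Holder_seminorm \<gamma>)
    (hilbert :: (real \<Rightarrow> 'k) \<Rightarrow> real \<Rightarrow> 'k) * (2 * pi) powr \<gamma>"

lemma c\<^sub>\<gamma>_nonneg: "0 \<le> c\<^sub>\<gamma>"
  using \<gamma> hilbert_norm_nonneg[OF \<gamma>, where 'k = 'k] by (simp add: c\<^sub>\<gamma>_def)

text \<open>Tensors are functionals on bilinear forms, so applying a tensor to this form evaluates its
  image under the operator at the point \<open>\<alpha>\<close>.\<close>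

definition form :: "real \<Rightarrow> (real \<Rightarrow> 'k) \<Rightarrow> (real \<Rightarrow> 'k) \<Rightarrow> 'k" where
  "form \<alpha> = (\<lambda>x y. K2_elem x y \<alpha>)"

text \<open>\<open>elem_tensor\<close> returns 0 outside the bilinear forms, so this membership is
  what lets a tensor see \<open>form \<alpha>\<close>. Compatibility with equality almost everywhere
  holds because the first argument enters only through its integral.\<close>

lemma form_bilinear: "form \<alpha> \<in> bilinear_forms ae_eq_half L1_half (Holder_even \<gamma>)"
proof -
  have "integral\<^sup>L (lebesgue_on {0..}) x = integral\<^sup>L (lebesgue_on {0..}) x'"
    if "x \<in> L1_half" "x' \<in> L1_half" "ae_eq_half x x'" for x x' :: "real \<Rightarrow> 'k"
    using that unfolding L1_half_def ae_eq_half_def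
    by (intro integral_cong_AE) (auto intro: borel_measurable_integrable)
  then show ?thesis
    unfolding bilinear_forms_def form_def K2_elem_def
    by (auto simp: L1_half_def K2_angular_hilbert[OF \<gamma>] Holder_even_subset hilbert_add[OF \<gamma>]
        hilbert_scale[OF \<gamma>] T.R.add_mem T.R.scale_mem algebra_simps)
qed

lemma norm_form_le:
  assumes "x \<in> L1_half" "y \<in> Holder_even \<gamma>"
  shows "norm (form \<alpha> x y) \<le> c\<^sub>\<gamma> * (L1_half_norm x * Holder_seminorm \<gamma> y)"
proof -
  have "norm (form \<alpha> x y) \<le> L1_half_norm x * (c\<^sub>\<gamma> * Holder_seminorm \<gamma> y)"
    unfolding form_def K2_elem_def norm_mult
  proof (rule mult_mono)
    show "norm (integral\<^sup>L (lebesgue_on {0..}) x) \<le> L1_half_norm x"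
      unfolding L1_half_norm_def by (rule integral_norm_bound)
    show "norm (K2_angular y \<alpha>) \<le> c\<^sub>\<gamma> * Holder_seminorm \<gamma> y"
      unfolding c\<^sub>\<gamma>_def using norm_K2_angular_le[OF \<gamma> Holder_even_subset[OF assms(2)]] .
  qed (use T.L.nonneg[OF assms(1)] in auto)
  then show ?thesis by (simp add: ac_simps)
qed

text \<open>One constant serves all \<alpha>; this uniformity later bounds the image by a constant
  function.\<close>

sublocale bounded_evaluation "K2_alg_dom \<gamma> :: 'k tensor set" "K2_alg_norm \<gamma>" "form \<alpha>" c\<^sub>\<gamma> for \<alpha>
  by unfold_locales (rule T.bilinear_form_bound[OF form_bilinear c\<^sub>\<gamma>_nonneg norm_form_le])

text \<open>Defined at every \<alpha>, not merely up to null sets, so that its algebraic laws are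
  exact equations.\<close>

definition K :: "(nat \<Rightarrow> 'k tensor) set \<Rightarrow> real \<Rightarrow> 'k" where
  "K U \<alpha> = completion_value U (form \<alpha>)"

text \<open>Before completion the image is a finite sum of scalar multiples of continuous periodic
  functions of \<alpha>; both properties below are stable under pointwise limits of
  sequences.\<close>

lemma tensor_form:
  assumes "u \<in> K2_alg_dom \<gamma>"
  shows "u (form (\<alpha> + 2 * pi)) = u (form \<alpha>)"
    and "(\<lambda>\<alpha>. u (form \<alpha>)) \<in> borel_measurable lebesgue"
proof -
  obtain n :: nat and x y where u: "\<forall>i<n. x i \<in> L1_half \<and> y i \<in> Holder_even \<gamma>"
    "u = (\<lambda>B. \<Sum>i<n. K2_tensor \<gamma> (x i) (y i) B)"
    using assms by (rule T.alg_tensorE)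
  have eq: "u (form \<alpha>) = (\<Sum>i<n. K2_elem (x i) (y i) \<alpha>)" for \<alpha>
    unfolding u(2) by (simp add: elem_tensor_def form_bilinear form_def[symmetric]) (simp add: form_def)
  show "u (form (\<alpha> + 2 * pi)) = u (form \<alpha>)"
    unfolding eq using u(1)
    by (intro sum.cong refl) (simp add: K2_elem_def K2_angular_periodic Holder_even_def Holder_def)
  have "K2_angular (y i) \<in> borel_measurable lebesgue" if "i < n" for i
    using continuous_K2_angular[OF \<gamma> Holder_even_subset] u(1) that
    by (intro measurable_completion) (auto intro: borel_measurable_continuous_onI)
  then show "(\<lambda>\<alpha>. u (form \<alpha>)) \<in> borel_measurable lebesgue"
    unfolding eq K2_elem_def by (intro borel_measurable_sum borel_measurable_times) auto
qed

lemma bounded_mem_F: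
  assumes "periodic g" "g \<in> borel_measurable lebesgue" "\<And>\<alpha>. norm (g \<alpha>) \<le> r"
  shows "g \<in> F" and "normF g \<le> r * normF (\<lambda>_. 1)"
proof -
  have r: "0 \<le> r" using order_trans[OF norm_ge_zero assms(3)] .
  have "g \<in> F \<and> normF g \<le> normF (\<lambda>_. of_real r)"
    using lattice assms r constants[of "of_real r"]
    unfolding periodic_banach_lattice_def by simp
  moreover have "normF (\<lambda>_. of_real r) = r * normF (\<lambda>_. 1)"
    using F.scale[OF constants, of "of_real r" 1] r by simp
  ultimately show "g \<in> F" "normF g \<le> r * normF (\<lambda>_. 1)" by auto
qed

lemma K_mem_F:
  assumes "U \<in> K2_dom \<gamma>"
  shows "K U \<in> F" and "normF (K U) \<le> c\<^sub>\<gamma> * K2_dom_norm \<gamma> U * normF (\<lambda>_. 1)"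
proof -
  obtain u where u: "u \<in> T.tensor.cauchy" "U = T.tensor.cls u"
    using assms by (rule T.tensor.completionE)
  note mem = T.tensor.cauchy_mem[OF u(1)]
  have lim: "(\<lambda>n. u n (form \<alpha>)) \<longlonglongrightarrow> K U \<alpha>" for \<alpha>
    unfolding K_def u(2) by (rule value_tendsto[OF u(1)])
  have "K U (\<alpha> + 2 * pi) = K U \<alpha>" for \<alpha>
    using lim[of "\<alpha> + 2 * pi"] unfolding tensor_form(1)[OF mem] by (rule LIMSEQ_unique[OF _ lim])
  then have "periodic (K U)" by (simp add: periodic_def)
  moreover have "K U \<in> borel_measurable lebesgue"
    using tensor_form(2)[OF mem] lim by (rule borel_measurable_LIMSEQ_metric)
  moreover have "norm (K U \<alpha>) \<le> c\<^sub>\<gamma> * K2_dom_norm \<gamma> U" for \<alpha>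
    unfolding K_def by (rule norm_value_le[OF assms])
  ultimately show "K U \<in> F" "normF (K U) \<le> c\<^sub>\<gamma> * K2_dom_norm \<gamma> U * normF (\<lambda>_. 1)"
    by (rule bounded_mem_F)+
qed

lemma K_embed: "v \<in> K2_alg_dom \<gamma> \<Longrightarrow> K (completion_embed (K2_alg_dom \<gamma>) (K2_alg_norm \<gamma>) v) \<alpha> = v (form \<alpha>)"
  unfolding K_def by (rule value_embed)

lemma K_add: "U \<in> K2_dom \<gamma> \<Longrightarrow> W \<in> K2_dom \<gamma> \<Longrightarrow> K (K2_dom_add \<gamma> U W) \<alpha> = K U \<alpha> + K W \<alpha>"
  unfolding K_def by (rule value_add)

lemma K_scale: "U \<in> K2_dom \<gamma> \<Longrightarrow> K (K2_dom_scale \<gamma> c U) \<alpha> = c * K U \<alpha>"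
  unfolding K_def by (rule value_scale)

lemma K_elem:
  assumes "x \<in> L1_half" "y \<in> Holder_even \<gamma>"
  shows "K (completion_embed (K2_alg_dom \<gamma>) (K2_alg_norm \<gamma>) (K2_tensor \<gamma> x y)) \<alpha> = K2_elem x y \<alpha>"
  unfolding K_embed[OF T.elem_tensor_mem[OF assms]]
  by (simp add: elem_tensor_def form_bilinear) (simp add: form_def)

text \<open>By exact linearity the difference of two images is the image of the difference, so
  continuity reduces to the norm bound. The other equations hold at every \<alpha>.\<close>

lemma is_K2_K: "is_K2 \<gamma> F normF K"
  unfolding is_K2_def
proof (intro conjI ballI allI impI)
  fix Us and U :: "(nat \<Rightarrow> 'k tensor) set"
  assume U: "U \<in> K2_dom \<gamma>" and *: "(\<forall>n. Us n \<in> K2_dom \<gamma>) \<and>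
        (\<lambda>n. K2_dom_norm \<gamma> (K2_dom_add \<gamma> (Us n) (K2_dom_scale \<gamma> (- 1) U))) \<longlonglongrightarrow> 0"
  let ?D = "\<lambda>n. K2_dom_add \<gamma> (Us n) (K2_dom_scale \<gamma> (- 1) U)"
  have D: "?D n \<in> K2_dom \<gamma>" for n
    using * U by (intro T.tensor.completion_add_mem T.tensor.completion_scale_mem) auto
  have eq: "(\<lambda>\<alpha>. K (Us n) \<alpha> - K U \<alpha>) = K (?D n)" for n
    using * U by (simp add: fun_eq_iff K_add K_scale T.tensor.completion_scale_mem)
  have "(\<lambda>n. c\<^sub>\<gamma> * K2_dom_norm \<gamma> (?D n) * normF (\<lambda>_. 1)) \<longlonglongrightarrow> c\<^sub>\<gamma> * 0 * normF (\<lambda>_. 1)"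
    using * by (intro tendsto_intros) auto
  then have lim: "(\<lambda>n. c\<^sub>\<gamma> * K2_dom_norm \<gamma> (?D n) * normF (\<lambda>_. 1)) \<longlonglongrightarrow> 0" by simp
  show "(\<lambda>n. normF (\<lambda>\<alpha>. K (Us n) \<alpha> - K U \<alpha>)) \<longlonglongrightarrow> 0"
    unfolding eq
    by (rule tendsto_sandwich[OF always_eventually always_eventually tendsto_const lim])
       (use K_mem_F[OF D] F.nonneg in auto)
qed (auto simp: K_mem_F K_add K_scale K_elem)

section \<open>Uniqueness of the extension\<close>

lemma normF_AE_zero:
  assumes "g \<in> F" "AE \<alpha> in lebesgue. g \<alpha> = 0"
  shows "normF g = 0"
proof -
  have "periodic g \<and> g \<in> borel_measurable lebesgue"
    using lattice assms(1) by (auto simp: periodic_banach_lattice_def)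
  \<comment> \<open>The lattice property with the zero function as majorant.\<close>
  then have "normF g \<le> normF (\<lambda>_. 0)"
    using lattice assms(2) F.zero_mem unfolding periodic_banach_lattice_def by fastforce
  with F.nonneg[OF assms(1)] show ?thesis by (simp add: F.zero)
qed

text \<open>Additivity of a competitor is known only almost everywhere, so the induction on the
  number of terms collects finitely many exceptional null sets.\<close>

lemma is_K2_unique_alg:
  fixes n :: nat
  assumes K': "is_K2 \<gamma> F normF K'" and "\<forall>i<n. x i \<in> L1_half \<and> y i \<in> Holder_even \<gamma>"
  defines "e \<equiv> completion_embed (K2_alg_dom \<gamma>) (K2_alg_norm \<gamma>)"
  shows "AE \<alpha> in lebesgue. K' (e (\<lambda>B. \<Sum>i<n. K2_tensor \<gamma> (x i) (y i) B)) \<alpha>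
    = K (e (\<lambda>B. \<Sum>i<n. K2_tensor \<gamma> (x i) (y i) B)) \<alpha>"
  using assms(2)
proof (induction n)
  case 0
  have "AE \<alpha> in lebesgue. K' (e (K2_tensor \<gamma> (\<lambda>_. 0) (\<lambda>_. 0))) \<alpha> = K2_elem (\<lambda>_. 0) (\<lambda>_. 0) \<alpha>"
    using K' T.L.zero_mem T.R.zero_mem unfolding is_K2_def e_def by blast
  then show ?case
    using K_elem[OF T.L.zero_mem T.R.zero_mem] by (simp add: e_def T.zero_tensor)
next
  case (Suc n)
  let ?u = "\<lambda>B. \<Sum>i<n. K2_tensor \<gamma> (x i) (y i) B" and ?v = "K2_tensor \<gamma> (x n) (y n)"
  have u: "?u \<in> K2_alg_dom \<gamma>" and v: "?v \<in> K2_alg_dom \<gamma>"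
    using Suc.prems by (auto intro: T.tensor_sum_mem T.elem_tensor_mem)
  then have mem: "e ?u \<in> K2_dom \<gamma>" "e ?v \<in> K2_dom \<gamma>"
    unfolding e_def by (auto intro: T.tensor.embed_mem_completion)
  have e: "e (\<lambda>B. \<Sum>i<Suc n. K2_tensor \<gamma> (x i) (y i) B) = K2_dom_add \<gamma> (e ?u) (e ?v)"
    using T.tensor.embed_add[OF u v] by (simp add: e_def)
  have "AE \<alpha> in lebesgue. K' (K2_dom_add \<gamma> (e ?u) (e ?v)) \<alpha> = K' (e ?u) \<alpha> + K' (e ?v) \<alpha>"
    using K' mem unfolding is_K2_def by blast
  moreover have "AE \<alpha> in lebesgue. K' (e ?v) \<alpha> = K (e ?v) \<alpha>"
    using K' Suc.prems K_elem unfolding is_K2_def e_def by simp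
  moreover have "AE \<alpha> in lebesgue. K' (e ?u) \<alpha> = K (e ?u) \<alpha>"
    using Suc by simp
  ultimately show ?case
    unfolding e by eventually_elim (simp add: K_add mem)
qed

lemma is_K2_unique:
  assumes K': "is_K2 \<gamma> F normF K'" and U: "U \<in> K2_dom \<gamma>"
  shows "AE \<alpha> in lebesgue. K' U \<alpha> = K U \<alpha>"
proof -
  obtain u where u: "u \<in> T.tensor.cauchy" "U = T.tensor.cls u"
    using U by (rule T.tensor.completionE)
  define e where "e n = completion_embed (K2_alg_dom \<gamma>) (K2_alg_norm \<gamma>) (u n)" for n
  note mem = T.tensor.cauchy_mem[OF u(1)]
  have e: "e n \<in> K2_dom \<gamma>" for n
    unfolding e_def by (rule T.tensor.embed_mem_completion[OF mem])
  have lim: "(\<lambda>n. K2_dom_norm \<gamma> (K2_dom_add \<gamma> (e n) (K2_dom_scale \<gamma> (- 1) U))) \<longlonglongrightarrow> 0"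
    unfolding e_def u(2) by (rule T.tensor.embed_tendsto[OF u(1)])
  \<comment> \<open>Kept general in \<open>J\<close> because the competitor and \<open>K\<close>
    both need it.\<close>
  have cont: "(\<lambda>n. normF (\<lambda>\<alpha>. J (e n) \<alpha> - J U \<alpha>)) \<longlonglongrightarrow> 0" if "is_K2 \<gamma> F normF J" for J
  proof -
    from that have "\<forall>Us. \<forall>U\<in>K2_dom \<gamma>. (\<forall>n. Us n \<in> K2_dom \<gamma>) \<and>
        (\<lambda>n. K2_dom_norm \<gamma> (K2_dom_add \<gamma> (Us n) (K2_dom_scale \<gamma> (- 1) U))) \<longlonglongrightarrow> 0 \<longrightarrow>
        (\<lambda>n. normF (\<lambda>\<alpha>. J (Us n) \<alpha> - J U \<alpha>)) \<longlonglongrightarrow> 0"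
      unfolding is_K2_def by (elim conjE)
    from this[rule_format, OF U, of e] e lim show ?thesis by simp
  qed
  have F: "J W \<in> F" if "is_K2 \<gamma> F normF J" "W \<in> K2_dom \<gamma>" for J W
  proof -
    from that(1) have "\<forall>U\<in>K2_dom \<gamma>. J U \<in> F" unfolding is_K2_def by (elim conjE)
    with that(2) show ?thesis by simp
  qed
  note F' = F[OF K'] F[OF is_K2_K]
  have AE: "AE \<alpha> in lebesgue. K' (e n) \<alpha> = K (e n) \<alpha>" for n
  proof -
    obtain m :: nat and x y where "\<forall>i<m. x i \<in> L1_half \<and> y i \<in> Holder_even \<gamma>"
      "u n = (\<lambda>B. \<Sum>i<m. K2_tensor \<gamma> (x i) (y i) B)"
      using mem[of n] by (rule T.alg_tensorE)
    then show ?thesis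
      unfolding e_def using is_K2_unique_alg[OF K', of m x y] by (simp only:)
  qed
  have zero: "normF (\<lambda>\<alpha>. K' (e n) \<alpha> - K (e n) \<alpha>) = 0" for n
    by (rule normF_AE_zero[OF F.diff_mem[OF F'(1)[OF e] F'(2)[OF e]]]) (use AE[of n] in simp)
  \<comment> \<open>The path from K' U to K U goes through the two images of e n, whose mutual
    distance is zero.\<close>
  have "normF (\<lambda>\<alpha>. K' U \<alpha> - K U \<alpha>)
      \<le> normF (\<lambda>\<alpha>. K' (e n) \<alpha> - K' U \<alpha>) + normF (\<lambda>\<alpha>. K (e n) \<alpha> - K U \<alpha>)" for n
    using F.diff_triangle[OF F'(1)[OF U] F'(1)[OF e[of n]] F'(2)[OF U]]
      F.diff_triangle[OF F'(1)[OF e[of n]] F'(2)[OF e[of n]] F'(2)[OF U]]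
    unfolding F.minus_commute[OF F'(1)[OF U] F'(1)[OF e[of n]]] zero[of n] by linarith
  moreover have "(\<lambda>n. normF (\<lambda>\<alpha>. K' (e n) \<alpha> - K' U \<alpha>) + normF (\<lambda>\<alpha>. K (e n) \<alpha> - K U \<alpha>)) \<longlonglongrightarrow> 0"
    using tendsto_add[OF cont[OF K'] cont[OF is_K2_K]] by simp
  ultimately have "normF (\<lambda>\<alpha>. K' U \<alpha> - K U \<alpha>) \<le> 0"
    by (intro LIMSEQ_le_const) auto
  with F.nonneg[OF F.diff_mem[OF F'(1)[OF U] F'(2)[OF U]]]
  have "normF (\<lambda>\<alpha>. K' U \<alpha> - K U \<alpha>) = 0" by simp
  moreover have "AE \<alpha> in lebesgue. f \<alpha> = 0" if "f \<in> F" "normF f = 0" for f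
    using lattice that by (simp add: periodic_banach_lattice_def)
  ultimately have "AE \<alpha> in lebesgue. K' U \<alpha> - K U \<alpha> = 0"
    using F.diff_mem[OF F'(1)[OF U] F'(2)[OF U]] by blast
  then show ?thesis by eventually_elim simp
qed

lemma K_le: "U \<in> K2_dom \<gamma> \<Longrightarrow> normF (K U) \<le> (c\<^sub>\<gamma> * normF (\<lambda>_. 1)) * K2_dom_norm \<gamma> U"
  using K_mem_F(2) by (simp add: ac_simps)

lemma bounded_K: "bounded_operator (K2_dom \<gamma>) (K2_dom_norm \<gamma>) normF K"
  unfolding bounded_operator_def using K_le by blast

lemma operator_norm_K: "operator_norm (K2_dom \<gamma>) (K2_dom_norm \<gamma>) normF K \<le> c\<^sub>\<gamma> * normF (\<lambda>_. 1)"
  using c\<^sub>\<gamma>_nonneg F.nonneg[OF constants] K_le by (intro operator_norm_le) auto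

end

theorem corollary9:
  fixes \<gamma> :: real
    and F :: "(real \<Rightarrow> 'k::{real_normed_field, banach, second_countable_topology}) set"
    and normF :: "(real \<Rightarrow> 'k) \<Rightarrow> real"
  assumes "0 < \<gamma>" and "\<gamma> < 1"
    and "periodic_banach_lattice F normF"
    and "\<forall>c. (\<lambda>_. c) \<in> F"
  shows "\<exists>K. is_K2 \<gamma> F normF K \<and>
             (\<forall>K'. is_K2 \<gamma> F normF K' \<longrightarrow> (\<forall>U\<in>K2_dom \<gamma>. AE \<alpha> in lebesgue. K' U \<alpha> = K U \<alpha>)) \<and>
             bounded_operator (K2_dom \<gamma>) (K2_dom_norm \<gamma>) normF K \<and>
             operator_norm (K2_dom \<gamma>) (K2_dom_norm \<gamma>) normF K
               \<le> (inverse \<gamma> * pi powr (\<gamma> - 1) +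
                  operator_norm (Holder \<gamma>) (Holder_seminorm \<gamma>) (Holder_seminorm \<gamma>)
                    (hilbert :: (real \<Rightarrow> 'k) \<Rightarrow> real \<Rightarrow> 'k) * (2 * pi) powr \<gamma>)
                 * normF (\<lambda>_. 1)"
proof -
  interpret K2_setting \<gamma> F normF
    using assms by unfold_locales auto
  show ?thesis
    using is_K2_K is_K2_unique bounded_K operator_norm_K unfolding c\<^sub>\<gamma>_def by blast
qed

end
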